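(* Let $k\ge4$ be an integer and let $\eta\in[\eta_{k+1},\eta_k)$. Then the vertices of the polygon $\mathrm{co}(K_\eta)$ are, in clockwise order, $b_0,z_0,z_1,\dots,z_k,w_1,\dots,w_k$.
   Context: For $\eta\in(0,\pi/3)$ let $a=\frac{e^{-i\eta}}{2\cos\eta}$ (so $|a|=\frac{1}{2\cos\eta}$), $f_1(z)=az$, $f_2(z)=1-\bar a z$, and let $K_\eta$ be the unique nonempty compact set with $K_\eta=f_1(K_\eta)\cup f_2(K_\eta)$. Let $c=\frac{1}{1-|a|^4}$ and for integers $j\ge0$ put $z_j=ca^{j+1}$, $w_j=1-c|a|^2a^j$, $b_j=a+c|a|^4a^j$. For integers $k\ge 1$ define $\Phi_k(\eta)=(1-|a|^4)\sin((k-1)\eta)-|a|^3\sin((k-2)\eta)+|a|^k\sin\eta$ (with $|a|=1/(2\cos\eta)$). For each integer $k\ge4$, $\Phi_k$ has a unique zero in the interval $(\pi/k,\pi/(k-1))$, denoted $\eta_k$. *)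

theory Defs
  imports "HOL-Analysis.Analysis"
begin

definition absa :: "real \<Rightarrow> real" where
  "absa \<eta> = 1 / (2 * cos \<eta>)"

definition aa :: "real \<Rightarrow> complex" where
  "aa \<eta> = cis (- \<eta>) / complex_of_real (2 * cos \<eta>)"

definition f1 :: "real \<Rightarrow> complex \<Rightarrow> complex" where
  "f1 \<eta> z = aa \<eta> * z"

definition f2 :: "real \<Rightarrow> complex \<Rightarrow> complex" where
  "f2 \<eta> z = 1 - cnj (aa \<eta>) * z"

definition cc :: "real \<Rightarrow> real" where
  "cc \<eta> = 1 / (1 - (cmod (aa \<eta>)) ^ 4)"

definition zz :: "real \<Rightarrow> nat \<Rightarrow> complex" where
  "zz \<eta> j = complex_of_real (cc \<eta>) * aa \<eta> ^ (j + 1)"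

definition ww :: "real \<Rightarrow> nat \<Rightarrow> complex" where
  "ww \<eta> j = 1 - complex_of_real (cc \<eta> * (cmod (aa \<eta>))\<^sup>2) * aa \<eta> ^ j"

definition bb :: "real \<Rightarrow> nat \<Rightarrow> complex" where
  "bb \<eta> j = aa \<eta> + complex_of_real (cc \<eta> * (cmod (aa \<eta>)) ^ 4) * aa \<eta> ^ j"

definition Phi :: "nat \<Rightarrow> real \<Rightarrow> real" where
  "Phi k \<eta> = (1 - absa \<eta> ^ 4) * sin ((real k - 1) * \<eta>)
              - absa \<eta> ^ 3 * sin ((real k - 2) * \<eta>) + absa \<eta> ^ k * sin \<eta>"

definition eta :: "nat \<Rightarrow> real" where
  "eta k = (THE t. pi / real k < t \<and> t < pi / (real k - 1) \<and> Phi k t = 0)"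

text \<open>The list vs is the list of vertices (extreme points) of the convex set S,
  each listed once, in clockwise cyclic order: for every directed edge
  vs!i -> vs!((i+1) mod n), all other vertices lie strictly to its right.\<close>
definition clockwise_vertices :: "complex list \<Rightarrow> complex set \<Rightarrow> bool" where
  "clockwise_vertices vs S \<longleftrightarrow>
     distinct vs \<and> set vs = {x. x extreme_point_of S} \<and>
     (\<forall>i < length vs. \<forall>j < length vs. j \<noteq> i \<and> j \<noteq> Suc i mod length vs \<longrightarrow>
        Im (cnj (vs ! (Suc i mod length vs) - vs ! i) * (vs ! j - vs ! i)) < 0)"

end

theory Submission
  imports Defs
begin

text \<open>
  Write \<open>r = \<bar>a\<bar>\<close> and \<open>V\<close> for the proposed list of vertices. All of \<open>V\<close> lies in \<open>K\<close>, since \<open>z\<^sub>0\<close> is the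
  fixed point of \<open>f\<^sub>2 f\<^sub>2 f\<^sub>1 f\<^sub>1\<close> and the remaining points are images of it under \<open>f\<^sub>1\<close> and \<open>f\<^sub>2\<close>.
  Conversely \<open>f\<^sub>1\<close> and \<open>f\<^sub>2\<close> map \<open>V\<close> into \<open>co V\<close>, and since they are contractions this gives
  \<open>K \<subseteq> co V\<close>. Both this and the strict convexity of the polygon are statements about points lying to
  the right of the edges. The edges inside the two spirals have directions \<open>\<plusminus>a\<^sup>j\<close>, so the
  conditions become trigonometric inequalities in \<open>sin (n\<eta>)\<close>, governed by
  \<open>sin (n\<eta>) = r (sin ((n+1)\<eta>) + sin ((n-1)\<eta>))\<close>. The point \<open>w\<^sub>1\<close> lies strictly to the right of the edge from
  \<open>z\<^bsub>k-1\<^esub>\<close> to \<open>z\<^sub>k\<close> iff \<open>\<Phi>\<^sub>k(\<eta>) > 0\<close>, and \<open>z\<^bsub>k+1\<^esub>\<close> lies to the right of the edge from \<open>z\<^sub>k\<close> to \<open>w\<^sub>1\<close> iff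
  \<open>\<Phi>\<^bsub>k+1\<^esub>(\<eta>) \<le> 0\<close>; the edge from \<open>w\<^sub>k\<close> to \<open>b\<^sub>0\<close> is the \<open>f\<^sub>2\<close>-image of the latter edge.
\<close>

section \<open>Convex polygons in the plane\<close>

text \<open>Cross product of \<open>q - p\<close> and \<open>x - p\<close>, with the sign convention
  of \<open>clockwise_vertices\<close>: negative means strictly to the right of the directed line
  from \<open>p\<close> to \<open>q\<close>.\<close>

definition turn :: "complex \<Rightarrow> complex \<Rightarrow> complex \<Rightarrow> real" where
  "turn p q x = Im (cnj (q - p) * (x - p))"

lemma turn_degenerate [simp]: "turn p q p = 0" "turn p q q = 0" "turn p p x = 0"
  by (simp_all add: turn_def algebra_simps)

lemma turn_rotate: "turn p q x = turn q x p"
  by (simp add: turn_def algebra_simps)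

lemma turn_eq_translate: "turn p q x = Im (cnj (q - p) * (x - q))"
  by (simp add: turn_def algebra_simps)

text \<open>A sum of two turns is again affine in \<open>x\<close>. Adding the two edges at a vertex
  gives one open half-plane that omits the vertex and contains all others.\<close>

lemma turn_convex: "convex {x. turn p q x + turn p' q' x < 0}"
proof -
  have "{x. turn p q x + turn p' q' x < 0} =
      {x. (- \<i> * (p - q) - \<i> * (p' - q')) \<bullet> x < (- \<i> * (p - q) ) \<bullet> p + (- \<i> * (p' - q')) \<bullet> p'}"
    by (auto simp: turn_def inner_complex_def algebra_simps)
  then show ?thesis by (simp add: convex_halfspace_lt)
qed

locale clockwise_polygon =
  fixes vs :: "complex list"
  assumes len: "length vs \<ge> 3"
    and right: "\<And>i j. \<lbrakk>i < length vs; j < length vs; j \<noteq> i; j \<noteq> Suc i mod length vs\<rbrakk>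
        \<Longrightarrow> turn (vs ! i) (vs ! (Suc i mod length vs)) (vs ! j) < 0"
begin

lemma pred_index:
  assumes "i < length vs"
  obtains h where "h < length vs" "Suc h mod length vs = i" "h \<noteq> i" "h \<noteq> Suc i mod length vs"
proof (cases i)
  case 0
  have "Suc (length vs - 1) = length vs"
    using len by simp
  then show ?thesis
    using len 0 by (intro that[of "length vs - 1"]) auto
next
  case (Suc m)
  show ?thesis
    using len assms Suc by (intro that[of m]) (auto simp: mod_Suc)
qed

text \<open>Equal entries have turn 0, which \<open>right\<close> forbids unless they are the two
  ends of one edge. That edge is then degenerate, and its turn vanishes at the predecessor
  too.\<close>

lemma distinct_vertices: "distinct vs"
proof -
  have "vs ! i \<noteq> vs ! j" if ij: "i < length vs" "j < length vs" "i \<noteq> j" for i j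
  proof
    assume eq: "vs ! i = vs ! j"
    have j: "j = Suc i mod length vs"
      using right[OF ij(1,2)] ij(3) eq by force
    obtain h where h: "h < length vs" "h \<noteq> i" "h \<noteq> Suc i mod length vs"
      using pred_index[OF ij(1)] by metis
    show False
      using right[OF ij(1) h] eq j by simp
  qed
  then show ?thesis by (simp add: distinct_conv_nth)
qed

lemma extreme_points: "{x. x extreme_point_of (convex hull (set vs))} = set vs"
proof
  show "{x. x extreme_point_of (convex hull (set vs))} \<subseteq> set vs"
    using extreme_point_of_convex_hull by blast
  show "set vs \<subseteq> {x. x extreme_point_of (convex hull (set vs))}"
  proof
    fix v assume v: "v \<in> set vs"
    then obtain i where i: "i < length vs" "v = vs ! i"
      by (auto simp: in_set_conv_nth)
    obtain h where h: "h < length vs" "Suc h mod length vs = i" "h \<noteq> i" "h \<noteq> Suc i mod length vs"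
      using pred_index[OF i(1)] by metis
    \<comment> \<open>Both turns vanish at \<open>v\<close>. At every other vertex both are
      negative, except that a neighbour of \<open>v\<close> has turn 0 for the edge it lies
      on.\<close>
    let ?H = "{x. turn (vs ! h) v x + turn v (vs ! (Suc i mod length vs)) x < 0}"
    have "set vs - {v} \<subseteq> ?H"
    proof
      fix u assume u: "u \<in> set vs - {v}"
      then obtain j where j: "j < length vs" "u = vs ! j" "j \<noteq> i"
        using i by (auto simp: in_set_conv_nth)
      have 1: "turn (vs ! h) v u < 0" if "j \<noteq> h"
        using right[OF h(1) j(1)] h(2) i j that by auto
      have 2: "turn v (vs ! (Suc i mod length vs)) u < 0" if "j \<noteq> Suc i mod length vs"
        using right[OF i(1) j(1)] i j that by auto
      show "u \<in> ?H"
        using 1 2 h(4) j(2) by (cases "j = h"; cases "j = Suc i mod length vs") auto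
    qed
    then have "convex hull (set vs - {v}) \<subseteq> ?H"
      by (intro hull_minimal turn_convex)
    then have "v \<notin> convex hull (set vs - {v})" by auto
    then have "v extreme_point_of (convex hull (insert v (set vs - {v})))"
      by (intro extreme_point_of_convex_hull_insert) auto
    then show "v \<in> {x. x extreme_point_of (convex hull (set vs))}"
      using v by (simp add: insert_absorb)
  qed
qed

lemma clockwise_vertices_hull: "clockwise_vertices vs (convex hull (set vs))"
  unfolding clockwise_vertices_def extreme_points
  using distinct_vertices right by (auto simp: turn_def)

text \<open>A separating functional attains its minimum over the vertices at some vertex v, and is then
  a nonnegative combination of the inner normals of the two edges at v.\<close>

lemma in_hull:
  assumes x: "\<And>i. i < length vs \<Longrightarrow> turn (vs ! i) (vs ! (Suc i mod length vs)) x \<le> 0"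
  shows "x \<in> convex hull (set vs)"
proof (rule ccontr)
  assume "x \<notin> convex hull (set vs)"
  moreover have "closed (convex hull (set vs))"
    by (simp add: compact_convex_hull compact_imp_closed finite_imp_compact)
  ultimately obtain u b where u: "u \<bullet> x < b" "\<And>y. y \<in> convex hull (set vs) \<Longrightarrow> u \<bullet> y > b"
    using separating_hyperplane_closed_point[of "convex hull (set vs)" x] convex_convex_hull by blast
  have "finite (set vs)" "set vs \<noteq> {}" using len by auto
  then obtain v where v: "v \<in> set vs" "\<And>y. y \<in> set vs \<Longrightarrow> u \<bullet> v \<le> u \<bullet> y"
    using arg_min_if_finite(1)[of "set vs" "\<lambda>y. u \<bullet> y"] arg_min_least[of "set vs" _ "\<lambda>y. u \<bullet> y"]
    by metis
  obtain i where i: "i < length vs" "v = vs ! i"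
    using v(1) by (auto simp: in_set_conv_nth)
  obtain h where h: "h < length vs" "Suc h mod length vs = i" "h \<noteq> i" "h \<noteq> Suc i mod length vs"
    using pred_index[OF i(1)] by metis
  define e where "e = v - vs ! h"
  define e' where "e' = vs ! (Suc i mod length vs) - v"
  have "Suc i mod length vs < length vs" using len by (intro mod_less_divisor) auto
  then have ue: "u \<bullet> e \<le> 0" "u \<bullet> e' \<ge> 0"
    using v(2) h(1) i by (auto simp: e_def e'_def inner_diff_right)
  \<comment> \<open>Cross product of the incoming and the outgoing edge, negative at a clockwise
    corner; so \<open>e\<close> and \<open>e'\<close> form a basis of the plane.\<close>
  define d where "d = Im (cnj e * e')"
  have "Suc i mod length vs \<noteq> i"
    using i len by (auto simp: mod_Suc)
  then have "d < 0"
    using right[OF h(1) \<open>Suc i mod length vs < length vs\<close>] h i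
    by (auto simp: turn_eq_translate d_def e_def e'_def)
  have xe: "Im (cnj e * (x - v)) \<le> 0" "Im (cnj e' * (x - v)) \<le> 0"
    using x[OF h(1)] x[OF i(1)] h(2) i(2) unfolding turn_eq_translate[of "vs ! h"]
    by (auto simp: turn_def e_def e'_def)
  \<comment> \<open>Cramer's rule for \<open>x - v\<close> in the basis \<open>e\<close>,
    \<open>e'\<close>, followed by the inner product with \<open>u\<close>.\<close>
  have "d * (u \<bullet> (x - v)) = (u \<bullet> e') * Im (cnj e * (x - v)) - (u \<bullet> e) * Im (cnj e' * (x - v))"
    by (simp add: d_def inner_complex_def algebra_simps)
  also have "\<dots> \<le> 0"
    using ue xe by (smt (verit) mult_nonneg_nonpos mult_nonpos_nonpos)
  finally have "u \<bullet> (x - v) \<ge> 0"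
    using \<open>d < 0\<close> by (simp add: mult_le_0_iff)
  moreover have "u \<bullet> x < u \<bullet> v"
    using u(1) u(2)[of v] v(1) hull_inc[of v "set vs" convex] by force
  ultimately show False by (simp add: inner_diff_right)
qed

end

text \<open>One strict turn is enough, because \<open>turn\<close> is invariant under cyclic
  rotation of its arguments.\<close>

lemma in_triangle_hull:
  assumes "turn p q s < 0" "turn p q x \<le> 0" "turn q s x \<le> 0" "turn s p x \<le> 0"
  shows "x \<in> convex hull {p, q, s}"
proof -
  have t: "turn q s p < 0" "turn s p q < 0"
    using assms(1) turn_rotate[of p q s] turn_rotate[of q s p] by simp_all
  have lt3: "i = 0 \<or> i = 1 \<or> i = 2" if "i < length [p, q, s]" for i
    using that by (simp, linarith)
  interpret clockwise_polygon "[p, q, s]"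
  proof
    fix i j
    assume ij: "i < length [p, q, s]" "j < length [p, q, s]" "j \<noteq> i" "j \<noteq> Suc i mod length [p, q, s]"
    show "turn ([p, q, s] ! i) ([p, q, s] ! (Suc i mod length [p, q, s])) ([p, q, s] ! j) < 0"
      using lt3[OF ij(1)] lt3[OF ij(2)] ij(3,4) assms(1) t by (elim disjE) simp_all
  qed simp
  have "x \<in> convex hull (set [p, q, s])"
  proof (rule in_hull)
    fix i assume i: "i < length [p, q, s]"
    show "turn ([p, q, s] ! i) ([p, q, s] ! (Suc i mod length [p, q, s])) x \<le> 0"
      using lt3[OF i] assms by (elim disjE) simp_all
  qed
  then show ?thesis by simp
qed

text \<open>A point of \<open>K\<close> at maximal distance from the hull is the image of a point of
  \<open>K\<close>, and both maps shrink the distance to the invariant hull by the factor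
  \<open>r < 1\<close>. So the maximal distance is 0.\<close>

lemma invariant_subset_hull:
  fixes f g :: "'a::euclidean_space \<Rightarrow> 'a"
  assumes "compact K" "K = f ` K \<union> g ` K" "finite V" "V \<noteq> {}"
    and f: "f ` (convex hull V) \<subseteq> convex hull V" and g: "g ` (convex hull V) \<subseteq> convex hull V"
    and lip: "\<And>p q. dist (f p) (f q) \<le> r * dist p q" "\<And>p q. dist (g p) (g q) \<le> r * dist p q"
    and r: "0 \<le> r" "r < 1"
  shows "K \<subseteq> convex hull V"
proof (cases "K = {}")
  case False
  let ?P = "convex hull V"
  have P: "closed ?P" "?P \<noteq> {}"
    using assms by (auto simp: compact_convex_hull compact_imp_closed finite_imp_compact)
  have "continuous_on K (\<lambda>y. infdist y ?P)"
    by (intro continuous_intros)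
  then obtain m where m: "m \<in> K" "\<And>y. y \<in> K \<Longrightarrow> infdist y ?P \<le> infdist m ?P"
    using continuous_attains_sup[OF assms(1) False] by blast
  have step: "infdist (h y) ?P \<le> r * infdist m ?P"
    if "y \<in> K" "h ` ?P \<subseteq> ?P" "\<And>p q. dist (h p) (h q) \<le> r * dist p q" for h y
  proof -
    obtain p where p: "p \<in> ?P" "infdist y ?P = dist y p"
      using infdist_attains_inf[OF P] by blast
    have "infdist (h y) ?P \<le> dist (h y) (h p)"
      using p that by (intro infdist_le) auto
    also have "\<dots> \<le> r * infdist y ?P" using that p by simp
    also have "\<dots> \<le> r * infdist m ?P" using m that r by (intro mult_left_mono) auto
    finally show ?thesis .
  qed
  obtain y where "y \<in> K" "m = f y \<or> m = g y" using m(1) assms(2) by blast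
  then have "infdist m ?P \<le> r * infdist m ?P" using step f g lip by metis
  then have "infdist m ?P \<le> 0"
    using r by (smt (verit, best) infdist_nonneg mult_le_cancel_right1 mult_right_le_one_le)
  then have "infdist y ?P = 0" if "y \<in> K" for y
    using m(2)[OF that] infdist_nonneg[of y ?P] by linarith
  then show ?thesis using P in_closed_iff_infdist_zero by blast
qed simp

section \<open>The zeros of \<open>\<Phi>\<^sub>k\<close>\<close>

text \<open>The index is an integer, so that differences of exponents of either sign can be inserted
  without case distinctions.\<close>

definition sm :: "real \<Rightarrow> int \<Rightarrow> real" where
  "sm \<eta> n = sin (of_int n * \<eta>)"

lemma sm_0 [simp]: "sm \<eta> 0 = 0"
  by (simp add: sm_def)

lemma sm_minus [simp]: "sm \<eta> (- n) = - sm \<eta> n"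
  by (simp add: sm_def)

lemma sm_1: "sm \<eta> 1 = sin \<eta>"
  by (simp add: sm_def)

lemma sm_rec:
  assumes "cos \<eta> > 0"
  shows "sm \<eta> n = absa \<eta> * (sm \<eta> (n + 1) + sm \<eta> (n - 1))"
  using assms by (simp add: sm_def absa_def algebra_simps sin_add sin_diff)

text \<open>Solutions of the recurrence \<open>sm_rec\<close> form a two-dimensional space, so two
  values determine a third.\<close>

lemma sm_interpolate:
  "sm \<eta> (m + j) * sm \<eta> N = sm \<eta> m * sm \<eta> (N - j) + sm \<eta> (m + N) * sm \<eta> j"
proof -
  have "sin (A + B) * sin C = sin A * sin (C - B) + sin (A + C) * sin B" for A B C :: real
    unfolding sin_add sin_diff by (simp add: algebra_simps)
  from this[of "of_int m * \<eta>" "of_int j * \<eta>" "of_int N * \<eta>"] show ?thesis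
    by (simp only: sm_def of_int_add of_int_diff distrib_right left_diff_distrib)
qed

lemma Phi_sm:
  "Phi k \<eta> = (1 - absa \<eta> ^ 4) * sm \<eta> (int k - 1) - absa \<eta> ^ 3 * sm \<eta> (int k - 2)
     + absa \<eta> ^ k * sm \<eta> 1"
  unfolding Phi_def sm_def
  by (simp only: of_int_diff of_int_of_nat_eq of_int_1 of_int_numeral mult_1)

section \<open>Bounds on |a| in terms of the angle\<close>

lemma sin_ge_sin:
  fixes \<theta> \<eta> :: real
  assumes "0 \<le> \<eta>" "\<eta> \<le> \<theta>" "\<theta> \<le> pi - \<eta>"
  shows "sin \<eta> \<le> sin \<theta>"
proof (cases "\<theta> \<le> pi / 2")
  case True
  then show ?thesis using assms by (intro sin_monotone_2pi_le) auto
next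
  case False
  then have "sin \<eta> \<le> sin (pi - \<theta>)" using assms by (intro sin_monotone_2pi_le) auto
  then show ?thesis by simp
qed

lemma absa_bounds:
  assumes "0 < \<eta>" "\<eta> < pi / 3"
  shows "0 < cos \<eta>" "0 < sin \<eta>" "1 / 2 < absa \<eta>" "absa \<eta> < 1"
proof -
  have "cos (pi / 3) < cos \<eta>" using assms by (intro cos_monotone_0_pi) auto
  then have c: "1 / 2 < cos \<eta>" by (simp add: cos_60)
  then show "0 < cos \<eta>" by simp
  show "0 < sin \<eta>" using assms by (intro sin_gt_zero) auto
  have "cos \<eta> < cos 0" using assms by (intro cos_monotone_0_pi) auto
  then show "1 / 2 < absa \<eta>" "absa \<eta> < 1" using c by (auto simp: absa_def field_simps)
qed

lemma absa_sq_lt_half: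
  assumes "0 < \<eta>" "\<eta> < pi / 4"
  shows "(absa \<eta>)\<^sup>2 < 1 / 2"
proof -
  have "cos (2 * \<eta>) > 0" using assms by (intro cos_gt_zero) auto
  then have "1 < 2 * (cos \<eta>)\<^sup>2" by (simp add: cos_double_cos)
  then show ?thesis
    by (auto simp: absa_def power_divide power_mult_distrib divide_less_eq)
qed

lemma absa_sq_le_half:
  assumes "0 < \<eta>" "\<eta> \<le> pi / 4"
  shows "(absa \<eta>)\<^sup>2 \<le> 1 / 2"
proof -
  have "cos (2 * \<eta>) \<ge> 0" using assms by (intro cos_ge_zero) auto
  then have "1 \<le> 2 * (cos \<eta>)\<^sup>2" by (simp add: cos_double_cos)
  then show ?thesis
    by (auto simp: absa_def power_divide power_mult_distrib divide_le_eq)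
qed

lemma absa_lt_of_sq:
  assumes "(absa \<eta>)\<^sup>2 \<le> 1 / 2"
  shows "absa \<eta> < 71 / 100"
proof (rule power2_less_imp_less)
  show "(absa \<eta>)\<^sup>2 < (71 / 100)\<^sup>2" using assms by (simp add: power2_eq_square)
qed simp

lemma half_le_absa_sq:
  assumes "pi / 4 \<le> \<eta>" "\<eta> < pi / 3"
  shows "1 / 2 \<le> (absa \<eta>)\<^sup>2"
proof -
  have c: "cos \<eta> > 0" using absa_bounds(1)[of \<eta>] assms by auto
  have "cos (2 * \<eta>) \<le> cos (pi / 2)"
    using assms by (intro cos_monotone_0_pi_le) auto
  then have "2 * (cos \<eta>)\<^sup>2 \<le> 1" by (simp add: cos_double_cos)
  then show ?thesis using c by (simp add: absa_def power_divide field_simps power_mult_distrib)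
qed

text \<open>Unrolling \<open>sm_rec\<close> gives polynomials in \<open>r ^ 2\<close> times
  \<open>sin \<eta>\<close>; these turn the smallest cases of \<open>k\<close> into polynomial
  inequalities.\<close>

lemma sm_multiples:
  assumes "cos \<eta> > 0"
  defines "r \<equiv> absa \<eta>"
  shows "r * sm \<eta> 2 = sm \<eta> 1" "r ^ 2 * sm \<eta> 3 = (1 - r\<^sup>2) * sm \<eta> 1"
    "r ^ 3 * sm \<eta> 4 = (1 - 2 * r\<^sup>2) * sm \<eta> 1"
    "r ^ 4 * sm \<eta> 5 = (1 - 3 * r\<^sup>2 + r ^ 4) * sm \<eta> 1"
    "r ^ 5 * sm \<eta> 6 = (1 - 4 * r\<^sup>2 + 3 * r ^ 4) * sm \<eta> 1"
proof -
  note rec = sm_rec[OF assms(1), folded r_def]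
  show 2: "r * sm \<eta> 2 = sm \<eta> 1" using rec[of 1] by simp
  have "r * sm \<eta> 3 = sm \<eta> 2 - r * sm \<eta> 1" using rec[of 2] by (simp add: algebra_simps)
  then show 3: "r ^ 2 * sm \<eta> 3 = (1 - r\<^sup>2) * sm \<eta> 1" using 2 by algebra
  have "r * sm \<eta> 4 = sm \<eta> 3 - r * sm \<eta> 2" using rec[of 3] by (simp add: algebra_simps)
  then show 4: "r ^ 3 * sm \<eta> 4 = (1 - 2 * r\<^sup>2) * sm \<eta> 1" using 2 3 by algebra
  have "r * sm \<eta> 5 = sm \<eta> 4 - r * sm \<eta> 3" using rec[of 4] by (simp add: algebra_simps)
  then show 5: "r ^ 4 * sm \<eta> 5 = (1 - 3 * r\<^sup>2 + r ^ 4) * sm \<eta> 1" using 3 4 by algebra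
  have "r * sm \<eta> 6 = sm \<eta> 5 - r * sm \<eta> 4" using rec[of 5] by (simp add: algebra_simps)
  then show "r ^ 5 * sm \<eta> 6 = (1 - 4 * r\<^sup>2 + 3 * r ^ 4) * sm \<eta> 1" using 4 5 by algebra
qed

text \<open>The factorisation locates the zero for k = 4 explicitly, at
  \<open>2 * absa \<eta> ^ 4 = 1\<close>.\<close>

lemma Phi_4:
  assumes "cos \<eta> > 0"
  shows "(absa \<eta>)\<^sup>2 * Phi 4 \<eta> = (1 - (absa \<eta>)\<^sup>2) * (1 - 2 * absa \<eta> ^ 4) * sin \<eta>"
proof -
  have "Phi 4 \<eta> = (1 - absa \<eta> ^ 4) * sm \<eta> 3 - absa \<eta> ^ 3 * sm \<eta> 2 + absa \<eta> ^ 4 * sm \<eta> 1"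
    using Phi_sm[of 4 \<eta>] by simp
  then show ?thesis
    using sm_multiples(1,2)[OF assms] unfolding sm_1[symmetric] by algebra
qed

lemma Phi_4_pos_iff:
  assumes "0 < \<eta>" "\<eta> < pi / 3"
  shows "Phi 4 \<eta> > 0 \<longleftrightarrow> 2 * absa \<eta> ^ 4 < 1" "Phi 4 \<eta> < 0 \<longleftrightarrow> 2 * absa \<eta> ^ 4 > 1"
proof -
  note b = absa_bounds[OF assms]
  have "(absa \<eta>)\<^sup>2 < 1" using b by (simp add: power_less_one_iff)
  then have p: "(1 - (absa \<eta>)\<^sup>2) * sin \<eta> > 0" using b by simp
  have e: "(absa \<eta>)\<^sup>2 * Phi 4 \<eta> = (1 - 2 * absa \<eta> ^ 4) * ((1 - (absa \<eta>)\<^sup>2) * sin \<eta>)"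
    using Phi_4[OF b(1)] by (simp add: mult_ac)
  have r: "(absa \<eta>)\<^sup>2 > 0" using b by simp
  have "Phi 4 \<eta> > 0 \<longleftrightarrow> (absa \<eta>)\<^sup>2 * Phi 4 \<eta> > 0" using r by (simp add: zero_less_mult_iff)
  also have "\<dots> \<longleftrightarrow> 1 - 2 * absa \<eta> ^ 4 > 0"
    unfolding e using p by (metis zero_less_mult_iff order.asym)
  also have "\<dots> \<longleftrightarrow> 2 * absa \<eta> ^ 4 < 1" by auto
  finally show "Phi 4 \<eta> > 0 \<longleftrightarrow> 2 * absa \<eta> ^ 4 < 1" .
  have "Phi 4 \<eta> < 0 \<longleftrightarrow> (absa \<eta>)\<^sup>2 * Phi 4 \<eta> < 0" using r by (simp add: mult_less_0_iff)
  also have "\<dots> \<longleftrightarrow> 1 - 2 * absa \<eta> ^ 4 < 0"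
    unfolding e using p by (metis mult_less_0_iff order.asym)
  also have "\<dots> \<longleftrightarrow> 2 * absa \<eta> ^ 4 > 1" by auto
  finally show "Phi 4 \<eta> < 0 \<longleftrightarrow> 2 * absa \<eta> ^ 4 > 1" .
qed

lemma absa_less:
  assumes "0 < s" "s < t" "t < pi / 3"
  shows "absa s < absa t"
proof -
  have "cos t < cos s" using assms by (intro cos_monotone_0_pi) auto
  then show ?thesis using absa_bounds(1)[of t] assms by (simp add: absa_def frac_less2)
qed

text \<open>The derivative is dominated by the term with \<open>cos ((k - 1) * u)\<close>, a cosine
  that is at most \<open>- cos u\<close> here. The other terms have a favourable sign or, since
  \<open>u \<le> pi / 4\<close>, are bounded by smaller multiples of \<open>cos u\<close>.\<close>

lemma Phi_decreasing:
  assumes k: "k \<ge> 5" and s: "pi / real k \<le> s" "s < t" "t \<le> pi / (real k - 1)"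
  shows "Phi k t < Phi k s"
proof (rule DERIV_neg_imp_decreasing[OF s(2)])
  fix u assume u: "s \<le> u" "u \<le> t"
  define p where "p = real k"
  have p: "p \<ge> 5" using k by (simp add: p_def)
  have "pi / p > 0" using p by simp
  then have u0: "u > 0" using s(1) u by (simp add: p_def)
  have "pi / p \<le> u" "u \<le> pi / (p - 1)" using s u by (auto simp: p_def)
  then have ku: "pi \<le> p * u" and ku': "(p - 1) * u \<le> pi"
    using p by (auto simp: field_simps)
  have "4 * u \<le> (p - 1) * u" using p u0 by (intro mult_right_mono) auto
  then have u4: "u \<le> pi / 4" using ku' by linarith
  note b = absa_bounds[of u]
  have b: "0 < cos u" "0 < sin u" "1 / 2 < absa u" "absa u < 1"
    using b u0 u4 pi_gt_zero by linarith+
  define r where "r = absa u"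
  have x: "r\<^sup>2 \<le> 1 / 2" using absa_sq_le_half[OF u0 u4] by (simp add: r_def)
  have rlt: "0 < r" "r < 71 / 100" "2 * r * cos u = 1"
    using absa_lt_of_sq[OF x[unfolded r_def]] b by (auto simp: r_def absa_def)
  have dabsa: "(absa has_real_derivative 2 * r\<^sup>2 * sin u) (at u)"
    unfolding absa_def[abs_def] using b
    by (auto intro!: derivative_eq_intros simp: r_def absa_def field_simps power2_eq_square)
  \<comment> \<open>Derivatives of the three summands of \<open>Phi\<close> in turn: the first two
    lines, the third line, and the terms with \<open>r ^ k\<close>.\<close>
  define D where "D = (1 - r ^ 4) * (p - 1) * cos ((p - 1) * u)
      - 8 * r ^ 5 * sin u * sin ((p - 1) * u)
      - (6 * r ^ 4 * sin u * sin ((p - 2) * u) + r ^ 3 * (p - 2) * cos ((p - 2) * u))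
      + (r ^ k * (2 * p * r * (sin u)\<^sup>2) + r ^ k * cos u)"
  have rk: "real k * (r ^ (k - Suc 0) * (r\<^sup>2 * sin u)) * 2 * sin u = r ^ k * (2 * p * r * (sin u)\<^sup>2)"
  proof -
    have "r ^ k = r * r ^ (k - Suc 0)" using k by (cases k) auto
    then show ?thesis by (simp add: p_def power2_eq_square)
  qed
  have "(Phi k has_real_derivative D) (at u)"
    unfolding Phi_def[abs_def]
    apply (rule derivative_eq_intros dabsa refl)+
    using rk
    apply (simp add: D_def p_def flip: r_def)
    apply (auto simp: algebra_simps eval_nat_numeral)
    done
  moreover have "D < 0"
  proof -
    have sin1: "sin ((p - 1) * u) \<ge> 0" "sin ((p - 2) * u) \<ge> 0"
      using ku' p u0 by (auto intro!: sin_ge_zero simp: algebra_simps)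
    have "cos ((p - 1) * u) \<le> cos (pi - u)"
      using ku ku' u4 by (intro cos_monotone_0_pi_le) (auto simp: algebra_simps)
    then have c1: "cos ((p - 1) * u) \<le> - cos u" by simp
    have "cos (pi - u) \<le> cos ((p - 2) * u)"
      using ku ku' u4 u0 p by (intro cos_monotone_0_pi_le) (auto simp: algebra_simps)
    then have c2: "- cos u \<le> cos ((p - 2) * u)" by simp
    have "cos (2 * u) \<ge> 0" using u0 u4 by (intro cos_ge_zero) auto
    then have "(sin u)\<^sup>2 \<le> (cos u)\<^sup>2" by (simp add: cos_double)
    then have "2 * r * (sin u)\<^sup>2 \<le> 2 * r * (cos u)\<^sup>2" using rlt by simp
    also have "\<dots> = cos u" using rlt(3) by (simp add: power2_eq_square)
    finally have c3: "2 * r * (sin u)\<^sup>2 \<le> cos u" .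
    have r4: "r ^ 4 \<le> 1 / 4"
      using mult_mono[OF x x] by (simp add: power2_eq_square eval_nat_numeral)
    have r3: "r ^ 3 \<le> 71 / 200"
      using mult_mono[OF x less_imp_le[OF rlt(2)]] rlt by (simp add: power2_eq_square eval_nat_numeral)
    have r5: "r ^ 5 \<le> 71 / 400"
      using mult_mono[OF x r3] rlt by (simp add: power2_eq_square eval_nat_numeral)
    have rk5: "r ^ k \<le> 71 / 400"
      using power_decreasing[of 5 k r] k rlt r5 by linarith
    have t1: "(1 - r ^ 4) * (p - 1) * cos ((p - 1) * u) \<le> - (3 / 4) * (p - 1) * cos u"
    proof -
      have "(1 - r ^ 4) * (p - 1) * cos ((p - 1) * u) \<le> (1 - r ^ 4) * (p - 1) * (- cos u)"
        using r4 p c1 by (intro mult_left_mono) auto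
      also have "\<dots> \<le> - (3 / 4) * (p - 1) * cos u"
        using mult_right_mono[of "3 / 4" "1 - r ^ 4" "(p - 1) * cos u"] r4 p b(1) by (simp add: algebra_simps)
      finally show ?thesis .
    qed
    have t2: "- (r ^ 3 * (p - 2) * cos ((p - 2) * u)) \<le> 71 / 200 * (p - 2) * cos u"
    proof -
      have "r ^ 3 * (p - 2) * (- cos ((p - 2) * u)) \<le> r ^ 3 * (p - 2) * cos u"
        using rlt p c2 by (intro mult_left_mono) auto
      also have "\<dots> \<le> 71 / 200 * (p - 2) * cos u"
        using r3 p b(1) by (intro mult_right_mono) auto
      finally show ?thesis by simp
    qed
    have t3: "r ^ k * (2 * p * r * (sin u)\<^sup>2) + r ^ k * cos u \<le> 71 / 400 * (p + 1) * cos u"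
    proof -
      have "r ^ k * (2 * p * r * (sin u)\<^sup>2) + r ^ k * cos u = r ^ k * (p * (2 * r * (sin u)\<^sup>2) + cos u)"
        by (simp add: algebra_simps)
      also have "\<dots> \<le> r ^ k * (p * cos u + cos u)"
        using c3 p rlt by (intro mult_left_mono add_mono) auto
      also have "\<dots> \<le> 71 / 400 * (p * cos u + cos u)"
        using rk5 p b(1) by (intro mult_right_mono) auto
      finally show ?thesis by (simp add: algebra_simps)
    qed
    have t4: "0 \<le> 8 * r ^ 5 * sin u * sin ((p - 1) * u)" "0 \<le> 6 * r ^ 4 * sin u * sin ((p - 2) * u)"
      using rlt b sin1 by auto
    have "D \<le> - (3 / 4) * (p - 1) * cos u + 71 / 200 * (p - 2) * cos u + 71 / 400 * (p + 1) * cos u"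
      unfolding D_def using t1 t2 t3 t4 by linarith
    also have "\<dots> = - (87 / 400) * (p - 1) * cos u" by (simp add: field_simps)
    also have "\<dots> < 0" using p b(1) by simp
    finally show ?thesis .
  qed
  ultimately show "\<exists>y. DERIV (Phi k) u :> y \<and> y < 0" by blast
qed

section \<open>The sign pattern of Phi_k and its zero\<close>

lemma continuous_on_Phi:
  assumes "\<And>t. t \<in> A \<Longrightarrow> cos t \<noteq> 0"
  shows "continuous_on A (Phi k)"
  unfolding Phi_def[abs_def] absa_def using assms by (auto intro!: continuous_intros)

text \<open>Replacing \<open>sm \<eta> (n - 1)\<close> by its two neighbours via
  \<open>sm_rec\<close> leaves only nonnegative coefficients; the bound on
  \<open>absa \<eta>\<close> is the sign of the coefficient of
  \<open>sm \<eta> (n - 2)\<close>.\<close>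

lemma Phi_left_pos:
  assumes "cos \<eta> > 0" "sin \<eta> > 0" "(absa \<eta>)\<^sup>2 + absa \<eta> ^ 4 \<le> 1"
    and "sm \<eta> (int n) \<ge> 0" "sm \<eta> (int n - 2) \<ge> 0"
  shows "Phi n \<eta> > 0"
proof -
  define r where "r = absa \<eta>"
  have r: "r > 0" using assms(1) by (simp add: r_def absa_def)
  have "sm \<eta> (int n - 1) = r * (sm \<eta> (int n) + sm \<eta> (int n - 2))"
    using sm_rec[OF assms(1), of "int n - 1"] by (simp add: r_def)
  then have "Phi n \<eta> = (1 - r ^ 4) * r * sm \<eta> (int n) + r * (1 - r\<^sup>2 - r ^ 4) * sm \<eta> (int n - 2)
      + r ^ n * sm \<eta> 1"
    by (simp add: Phi_sm flip: r_def) (simp add: algebra_simps eval_nat_numeral)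
  moreover have "r ^ 4 \<le> 1" using assms(3) zero_le_power2[of r] unfolding r_def by linarith
  then have "(1 - r ^ 4) * r * sm \<eta> (int n) \<ge> 0"
    using assms r by auto
  moreover have "r * (1 - r\<^sup>2 - r ^ 4) * sm \<eta> (int n - 2) \<ge> 0"
    using assms r by (auto simp flip: r_def)
  moreover have "r ^ n * sm \<eta> 1 > 0" using r assms by (simp add: sm_1)
  ultimately show ?thesis by linarith
qed

lemma sm_nonneg:
  assumes "0 \<le> n" "0 \<le> \<eta>" "of_int n * \<eta> \<le> pi"
  shows "sm \<eta> n \<ge> 0"
  unfolding sm_def using assms by (intro sin_ge_zero) auto

lemma Phi_pos_le:
  assumes k: "k \<ge> 4" and \<eta>: "0 < \<eta>" "\<eta> \<le> pi / real k"
  shows "Phi k \<eta> > 0"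
proof (rule Phi_left_pos)
  have "pi / real k \<le> pi / 4" using k by (intro divide_left_mono) auto
  then have \<eta>4: "\<eta> \<le> pi / 4" using \<eta> by linarith
  show "cos \<eta> > 0" "sin \<eta> > 0" using absa_bounds(1,2)[of \<eta>] \<eta> \<eta>4 pi_gt_zero by linarith+
  have x: "(absa \<eta>)\<^sup>2 \<le> 1 / 2" using absa_sq_le_half \<eta> \<eta>4 by simp
  have "absa \<eta> ^ 4 \<le> 1 / 4"
    using mult_mono[OF x x] by (simp add: power2_eq_square eval_nat_numeral)
  then show "(absa \<eta>)\<^sup>2 + absa \<eta> ^ 4 \<le> 1" using x by simp
  have "real k * \<eta> \<le> pi" using \<eta> k by (simp add: field_simps)
  then show "sm \<eta> (int k) \<ge> 0" "sm \<eta> (int k - 2) \<ge> 0"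
    using \<eta> k by (auto intro!: sm_nonneg simp: algebra_simps)
qed

text \<open>At this angle only \<open>(r ^ k - r ^ 3) * sin \<eta>\<close> is left, with
  \<open>r = absa \<eta>\<close>. For k = 4 the angle would be \<open>pi / 3\<close>, where
  \<open>r = 1\<close> and the value is 0.\<close>

lemma Phi_neg_at:
  assumes k: "k \<ge> 5"
  shows "Phi k (pi / (real k - 1)) < 0"
proof -
  define \<eta> where "\<eta> = pi / (real k - 1)"
  have "pi / (real k - 1) \<le> pi / 4" using k by (intro divide_left_mono) auto
  then have \<eta>: "0 < \<eta>" "\<eta> < pi / 3" using k pi_gt_zero unfolding \<eta>_def by (simp, linarith)
  note b = absa_bounds[OF \<eta>]
  have e: "(real k - 1) * \<eta> = pi" using k by (simp add: \<eta>_def)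
  then have "(real k - 2) * \<eta> = pi - \<eta>" by (simp add: algebra_simps)
  then have "Phi k \<eta> = (absa \<eta> ^ k - absa \<eta> ^ 3) * sin \<eta>"
    by (simp add: Phi_def e algebra_simps)
  moreover have "absa \<eta> ^ k < absa \<eta> ^ 3" using b k by (intro power_strict_decreasing) auto
  ultimately show ?thesis using b by (simp add: mult_less_0_iff flip: \<eta>_def)
qed

text \<open>Justifies the definite description in \<open>eta\<close> and records the sign change
  there. Uniqueness comes from monotonicity for k >= 5 and from the factorisation
  \<open>Phi_4\<close> for k = 4.\<close>

lemma eta_characterization:
  assumes k: "k \<ge> 4"
  shows "pi / real k < eta k \<and> eta k < pi / (real k - 1) \<and> Phi k (eta k) = 0 \<and>
     (\<forall>t. pi / real k < t \<longrightarrow> t < eta k \<longrightarrow> Phi k t > 0) \<and>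
     (\<forall>t. eta k < t \<longrightarrow> t < pi / (real k - 1) \<longrightarrow> Phi k t < 0)"
proof -
  have "\<exists>z. pi / real k < z \<and> z < pi / (real k - 1) \<and> Phi k z = 0 \<and>
     (\<forall>t. pi / real k < t \<longrightarrow> t < z \<longrightarrow> Phi k t > 0) \<and>
     (\<forall>t. z < t \<longrightarrow> t < pi / (real k - 1) \<longrightarrow> Phi k t < 0)"
  proof (cases "k = 4")
    case True
    \<comment> \<open>The equation is \<open>2 * absa z ^ 4 = 1\<close>. The intermediate value
      theorem is not applied to \<open>Phi 4\<close> itself because that vanishes at
      \<open>pi / 3\<close>.\<close>
    have "\<exists>z\<ge>pi/4. z \<le> pi/3 \<and> (\<lambda>t. 8 * cos t ^ 4) z = 1"
      by (intro IVT2' continuous_intros)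
         (auto simp: cos_45 cos_60 power_divide eval_nat_numeral)
    then obtain z where z: "pi/4 \<le> z" "z \<le> pi/3" "8 * cos z ^ 4 = 1" by auto
    have "8 * cos (pi / 4) ^ 4 = (2::real)" "8 * cos (pi / 3) ^ 4 = (1 / 2 :: real)"
      by (auto simp: cos_45 cos_60 power_divide eval_nat_numeral)
    then have "z \<noteq> pi/4" "z \<noteq> pi/3" using z(3) by force+
    then have z': "pi/4 < z" "z < pi/3" using z by auto
    have "absa z ^ 4 = 1 / (16 * cos z ^ 4)" by (simp add: absa_def power_divide power_mult_distrib)
    then have az: "2 * absa z ^ 4 = 1" using z(3) by (simp add: field_simps)
    have "Phi 4 t > 0" if "pi/4 < t" "t < z" for t
    proof -
      have t: "0 < t" using that pi_gt_zero by linarith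
      have "absa t ^ 4 < absa z ^ 4"
        using that t absa_less[of t z] z' absa_bounds(3)[of t] by (intro power_strict_mono) auto
      then show ?thesis using Phi_4_pos_iff(1)[of t] that z' az t by auto
    qed
    moreover have "Phi 4 t < 0" if "z < t" "t < pi/3" for t
    proof -
      have t: "0 < z" using z' pi_gt_zero by linarith
      have "absa z ^ 4 < absa t ^ 4"
        using that t absa_less[of z t] z' absa_bounds(3)[of z] by (intro power_strict_mono) auto
      then show ?thesis using Phi_4_pos_iff(2)[of t] that z' az t by auto
    qed
    moreover have "Phi 4 z = 0"
    proof -
      have t: "0 < z" using z' pi_gt_zero by linarith
      then show ?thesis using Phi_4_pos_iff[of z] z' az by linarith
    qed
    ultimately show ?thesis using z' True by auto
  next
    case False
    then have k5: "k \<ge> 5" using k by simp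
    let ?l = "pi / real k" and ?u = "pi / (real k - 1)"
    have lu: "?l < ?u" using k5 by (intro divide_strict_left_mono) auto
    have u4: "?u \<le> pi / 4" using k5 by (intro divide_left_mono) auto
    have l0: "0 < ?l" using k5 by simp
    have "continuous_on {?l..?u} (Phi k)"
    proof (intro continuous_on_Phi less_imp_neq[OF cos_gt_zero, symmetric])
      fix t assume "t \<in> {?l..?u}"
      then have "?l \<le> t" "t \<le> ?u" by auto
      then show "0 < t" "t < pi / 2" using u4 l0 pi_gt_zero by linarith+
    qed
    moreover have l: "Phi k ?l > 0" using k by (intro Phi_pos_le) auto
    moreover have u: "Phi k ?u < 0" using Phi_neg_at[OF k5] .
    ultimately have "\<exists>z\<ge>?l. z \<le> ?u \<and> Phi k z = 0"
      using lu by (intro IVT2') auto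
    then obtain z where z: "?l \<le> z" "z \<le> ?u" "Phi k z = 0" by auto
    have "?l < z" "z < ?u" using z l u by (auto simp: order_less_le)
    moreover have "Phi k t > 0" if "?l < t" "t < z" for t
      using Phi_decreasing[OF k5, of t z] that z by auto
    moreover have "Phi k t < 0" if "z < t" "t < ?u" for t
      using Phi_decreasing[OF k5, of z t] that z by auto
    ultimately show ?thesis using z by blast
  qed
  then obtain z where z: "pi / real k < z" "z < pi / (real k - 1)" "Phi k z = 0"
     "\<And>t. pi / real k < t \<Longrightarrow> t < z \<Longrightarrow> Phi k t > 0"
     "\<And>t. z < t \<Longrightarrow> t < pi / (real k - 1) \<Longrightarrow> Phi k t < 0" by blast
  have "eta k = z"
    unfolding eta_def
  proof (rule the_equality)
    fix t assume t: "pi / real k < t \<and> t < pi / (real k - 1) \<and> Phi k t = 0"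
    show "t = z" using z(4)[of t] z(5)[of t] t by (cases t z rule: linorder_cases) auto
  qed (use z in blast)
  then show ?thesis using z by blast
qed

text \<open>\<open>eta_characterization\<close> for k + 1 reaches only up to \<open>pi / k\<close>;
  this covers the angles from there on. For k >= 6 the hypothesis \<open>pos\<close> bounds
  \<open>sm \<eta> (k - 1)\<close> from below, and the term containing it outweighs the last term of
  \<open>Phi (k + 1)\<close>.\<close>

lemma Phi_Suc_nonpos:
  assumes k: "k \<ge> 4" and \<eta>: "pi / real k \<le> \<eta>" "\<eta> < pi / (real k - 1)" and pos: "Phi k \<eta> > 0"
  shows "Phi (k + 1) \<eta> \<le> 0"
proof -
  define r where "r = absa \<eta>"
  define y where "y = 1 - r ^ 4"
  have "0 < pi / real k" using k by simp
  then have \<eta>0: "0 < \<eta>" using \<eta> by linarith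
  have "pi / (real k - 1) \<le> pi / 3" using k by (intro divide_left_mono) auto
  then have \<eta>3: "\<eta> < pi / 3" using \<eta> by linarith
  note b = absa_bounds[OF \<eta>0 \<eta>3, folded r_def]
  have s1: "sm \<eta> 1 > 0" using b by (simp add: sm_1)
  have k1: "real k * \<eta> \<ge> pi" "(real k - 1) * \<eta> < pi" using \<eta> k by (auto simp: field_simps)
  have skle: "sm \<eta> (int k) \<le> 0"
  proof -
    have "sin (real k * \<eta> - pi) \<ge> 0"
      using k1 \<eta>3 pi_gt_zero by (intro sin_ge_zero) (auto simp: algebra_simps)
    then show ?thesis by (simp add: sm_def)
  qed
  note mult = sm_multiples[OF b(1), folded r_def]
  have F: "Phi (k + 1) \<eta> = y * sm \<eta> (int k) - r ^ 3 * sm \<eta> (int k - 1) + r ^ (k + 1) * sm \<eta> 1"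
    using Phi_sm[of "k + 1" \<eta>] by (simp add: r_def y_def)
  consider "k = 4" | "k = 5" | "k \<ge> 6" using k by linarith
  then show ?thesis
  proof cases
    case 1
    have x: "1 / 2 \<le> r\<^sup>2" using half_le_absa_sq[of \<eta>] \<eta> \<eta>3 1 by (simp add: r_def)
    have x2: "2 * r ^ 4 < 1" using Phi_4_pos_iff(1)[OF \<eta>0 \<eta>3] pos 1 by (simp add: r_def)
    \<comment> \<open>Regrouped so that the two known facts, \<open>2 * r ^ 4 < 1\<close> and
      \<open>1 / 2 \<le> r ^ 2\<close>, decide the sign of each part.\<close>
    have "r ^ 3 * Phi 5 \<eta> = ((2 * r ^ 4 - 1) * (r ^ 4 / 2 + 3 / 2 * r\<^sup>2 - 3 / 4) + (1 / 4 - r\<^sup>2 / 2)) * sm \<eta> 1"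
    proof -
      have "Phi 5 \<eta> = y * sm \<eta> 4 - r ^ 3 * sm \<eta> 3 + r ^ 5 * sm \<eta> 1" using F 1 by simp
      then have "r ^ 3 * Phi 5 \<eta> = y * (r ^ 3 * sm \<eta> 4) - r ^ 4 * (r ^ 2 * sm \<eta> 3) + r ^ 8 * sm \<eta> 1"
        by algebra
      also have "\<dots> = (y * (1 - 2 * r\<^sup>2) - r ^ 4 * (1 - r\<^sup>2) + r ^ 8) * sm \<eta> 1"
        unfolding mult by (simp add: algebra_simps)
      also have "y * (1 - 2 * r\<^sup>2) - r ^ 4 * (1 - r\<^sup>2) + r ^ 8
          = (2 * r ^ 4 - 1) * (r ^ 4 / 2 + 3 / 2 * r\<^sup>2 - 3 / 4) + (1 / 4 - r\<^sup>2 / 2)"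
        by (simp add: y_def algebra_simps eval_nat_numeral)
      finally show ?thesis .
    qed
    moreover have "(2 * r ^ 4 - 1) * (r ^ 4 / 2 + 3 / 2 * r\<^sup>2 - 3 / 4) \<le> 0"
      using x x2 zero_le_power[of r 4] b by (intro mult_nonpos_nonneg) linarith+
    ultimately have "r ^ 3 * Phi 5 \<eta> \<le> 0"
      using x s1 by (simp only:) (intro mult_nonpos_nonneg, auto)
    then show ?thesis using b 1 by (simp add: mult_le_0_iff)
  next
    case 2
    have x: "r\<^sup>2 < 1 / 2" using absa_sq_lt_half[of \<eta>] \<eta> \<eta>0 2 by (simp add: r_def)
    define x where "x = r\<^sup>2"
    have r4: "r ^ 4 = x\<^sup>2" by (simp add: x_def)
    have "r ^ 4 * sm \<eta> 5 \<le> 0" using skle 2 b by (simp add: mult_le_0_iff)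
    then have "(1 - 3 * x + x\<^sup>2) * sm \<eta> 1 \<le> 0" using mult(4) by (simp add: x_def)
    then have q: "1 - 3 * x + x\<^sup>2 \<le> 0" using s1 by (simp add: mult_le_0_iff)
    have x0: "x < 1 / 2" "x > 0" using x b by (auto simp: x_def)
    \<comment> \<open>The constants are roundings of the roots \<open>(3 - sqrt 5) / 2\<close> and
      \<open>(3 + sqrt 5) / 2\<close> of the quadratic in \<open>q\<close>.\<close>
    have x1: "x > 38 / 100"
    proof (rule ccontr)
      assume "\<not> x > 38 / 100"
      then have "(38 / 100 - x) * (262 / 100 - x) \<ge> 0" by (intro mult_nonneg_nonneg) auto
      then show False using q by (simp add: field_simps power2_eq_square)
    qed
    have "r ^ 4 * Phi 6 \<eta> = (1 - 3 * x - x\<^sup>2 + 5 * x ^ 3 - x ^ 4 + x ^ 5) * sm \<eta> 1"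
    proof -
      have "Phi 6 \<eta> = y * sm \<eta> 5 - r ^ 3 * sm \<eta> 4 + r ^ 6 * sm \<eta> 1" using F 2 by simp
      then have "r ^ 4 * Phi 6 \<eta> = y * (r ^ 4 * sm \<eta> 5) - r ^ 4 * (r ^ 3 * sm \<eta> 4) + r ^ 10 * sm \<eta> 1"
        by algebra
      also have "\<dots> = (y * (1 - 3 * r\<^sup>2 + r ^ 4) - r ^ 4 * (1 - 2 * r\<^sup>2) + r ^ 10) * sm \<eta> 1"
        unfolding mult by (simp add: algebra_simps)
      also have "y * (1 - 3 * r\<^sup>2 + r ^ 4) - r ^ 4 * (1 - 2 * r\<^sup>2) + r ^ 10
          = 1 - 3 * x - x\<^sup>2 + 5 * x ^ 3 - x ^ 4 + x ^ 5"
        by (simp add: y_def x_def algebra_simps eval_nat_numeral)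
      finally show ?thesis .
    qed
    moreover have "1 - 3 * x - x\<^sup>2 + 5 * x ^ 3 - x ^ 4 + x ^ 5 \<le> 0"
    proof -
      have neg: "u + v - w \<le> 0" if "u \<le> 0" "v \<le> 0" "w \<ge> 0" for u v w :: real
        using that by linarith
      have "(x - 38 / 100) * (x - 1 / 2) * (5 * x + 34 / 10) \<le> 0"
        using x0 x1 by (intro mult_nonpos_nonneg mult_nonneg_nonpos) auto
      moreover have "x ^ 4 * (1 - x) \<ge> 0" using x0 by simp
      \<comment> \<open>Division of the cubic part by \<open>(x - 38 / 100) * (x - 1 / 2)\<close>,
        built from the bounds on \<open>x\<close>, with a linear remainder.\<close>
      moreover have "1 - 3 * x - x\<^sup>2 + 5 * x ^ 3 - x ^ 4 + x ^ 5
          = (x - 38 / 100) * (x - 1 / 2) * (5 * x + 34 / 10) + (354 - 958 * x) / 1000 - x ^ 4 * (1 - x)"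
        by (simp add: field_simps eval_nat_numeral)
      moreover have "(354 - 958 * x) / 1000 \<le> 0" using x1 by simp
      ultimately show ?thesis using neg by presburger
    qed
    ultimately have "r ^ 4 * Phi 6 \<eta> \<le> 0" using s1 by (simp add: mult_le_0_iff)
    then show ?thesis using b 2 by (simp add: mult_le_0_iff)
  next
    case 3
    have "pi / (real k - 1) \<le> pi / 4" using 3 by (intro divide_left_mono) auto
    then have "\<eta> < pi / 4" using \<eta> by linarith
    then have x: "r\<^sup>2 \<le> 1 / 2" using absa_sq_lt_half[of \<eta>] \<eta>0 by (simp add: r_def)
    have r: "r < 71 / 100" using absa_lt_of_sq x by (simp add: r_def)
    have sk2: "sm \<eta> (int k - 2) \<ge> sm \<eta> 1"
      unfolding sm_def using \<eta>0 k k1 by (intro sin_ge_sin) (auto simp: algebra_simps)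
    have "r ^ 4 \<le> 1 / 4"
      using mult_mono[OF x x] by (simp add: power2_eq_square eval_nat_numeral)
    then have y: "y > 0" by (simp add: y_def)
    have "y * sm \<eta> (int k - 1) > r ^ 3 * sm \<eta> (int k - 2) - r ^ k * sm \<eta> 1"
      using pos unfolding Phi_sm by (simp add: r_def y_def)
    moreover have "r ^ 3 * sm \<eta> (int k - 2) \<ge> r ^ 3 * sm \<eta> 1"
      using sk2 b by (intro mult_left_mono) auto
    ultimately have h: "y * sm \<eta> (int k - 1) \<ge> (r ^ 3 - r ^ k) * sm \<eta> 1"
      by (simp add: algebra_simps)
    have "k = (k - 2) + 2" using k by simp
    then have rk: "r ^ k = r ^ (k - 2) * r\<^sup>2" by (metis power_add)
    \<comment> \<open>With \<open>h\<close> this gives \<open>sm \<eta> (k - 1)\<close> the size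
      needed to absorb the last term of \<open>F\<close>. It rests on
      \<open>r ^ (k - 2) \<le> r ^ 4\<close>, \<open>y + r ^ 2 \<le> 5 / 4\<close> and
      \<open>r * (5 / 4) < 1\<close>.\<close>
    have "y * r ^ (k - 2) \<le> r ^ 3 - r ^ k"
    proof -
      have "r ^ (k - 2) * (y + r\<^sup>2) \<le> r ^ 4 * (5 / 4)"
      proof (intro mult_mono)
        show "r ^ (k - 2) \<le> r ^ 4" using b 3 by (intro power_decreasing) auto
        have "(r\<^sup>2 - 1 / 2)\<^sup>2 \<ge> 0" by simp
        then show "y + r\<^sup>2 \<le> 5 / 4" by (simp add: y_def power2_eq_square algebra_simps eval_nat_numeral)
      qed (use y b in auto)
      also have "\<dots> = r ^ 3 * (r * (5 / 4))" by (simp add: eval_nat_numeral)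
      also have "\<dots> \<le> r ^ 3" using b r by (simp add: mult_left_le)
      finally show ?thesis unfolding rk by (simp add: algebra_simps)
    qed
    then have "y * r ^ (k - 2) * sm \<eta> 1 \<le> (r ^ 3 - r ^ k) * sm \<eta> 1"
      using s1 by (intro mult_right_mono) auto
    then have "y * (r ^ (k - 2) * sm \<eta> 1) \<le> y * sm \<eta> (int k - 1)" using h by (simp add: mult.assoc)
    then have "r ^ (k - 2) * sm \<eta> 1 \<le> sm \<eta> (int k - 1)" using y by simp
    then have "r ^ 3 * (r ^ (k - 2) * sm \<eta> 1) \<le> r ^ 3 * sm \<eta> (int k - 1)"
      using b by (intro mult_left_mono) auto
    moreover have "r ^ 3 * r ^ (k - 2) = r ^ (k + 1)" using k by (simp flip: power_add)
    moreover have "y * sm \<eta> (int k) \<le> 0" using y skle by (simp add: mult_le_0_iff)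
    ultimately show ?thesis unfolding F by (simp add: mult.assoc[symmetric])
  qed
qed

text \<open>Trades the range between consecutive zeros for an angle window and two signs, which are
  all that the geometry uses. The last sign comes from \<open>eta_characterization\<close> below
  \<open>pi / k\<close> and from \<open>Phi_Suc_nonpos\<close> from there on.\<close>

lemma eta_regime:
  assumes k: "k \<ge> 4" and \<eta>: "eta (k + 1) \<le> \<eta>" "\<eta> < eta k"
  shows "pi / (real k + 1) < \<eta>" "\<eta> < pi / (real k - 1)" "Phi k \<eta> > 0" "Phi (k + 1) \<eta> \<le> 0"
proof -
  note a = eta_characterization[OF k]
  have b: "pi / (real k + 1) < eta (k + 1) \<and> eta (k + 1) < pi / real k \<and> Phi (k + 1) (eta (k + 1)) = 0 \<and>
     (\<forall>t. eta (k + 1) < t \<longrightarrow> t < pi / real k \<longrightarrow> Phi (k + 1) t < 0)"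
    using eta_characterization[of "k + 1"] k by (simp add: add.commute)
  show 1: "pi / (real k + 1) < \<eta>" "\<eta> < pi / (real k - 1)" using a b \<eta> by linarith+
  have "0 < pi / (real k + 1)" by simp
  then have "0 < \<eta>" using 1 by linarith
  then show pos: "Phi k \<eta> > 0"
    using a \<eta> Phi_pos_le[OF k] by (cases "\<eta> \<le> pi / real k") auto
  show "Phi (k + 1) \<eta> \<le> 0"
  proof (cases "\<eta> < pi / real k")
    case True
    then show ?thesis using b \<eta> by (cases "\<eta> = eta (k + 1)") force+
  next
    case False
    then show ?thesis using Phi_Suc_nonpos[OF k _ 1(2) pos] by simp
  qed
qed

section \<open>Trigonometric inequalities\<close>

locale spiral_regime =
  fixes k :: nat and \<eta> :: real
  assumes k4: "k \<ge> 4"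
    and lower: "pi / (real k + 1) < \<eta>" and upper: "\<eta> < pi / (real k - 1)"
    and Phi_pos: "Phi k \<eta> > 0" and Phi_Suc_le: "Phi (k + 1) \<eta> \<le> 0"
begin

abbreviation "r \<equiv> absa \<eta>"
abbreviation "S \<equiv> sm \<eta>"
abbreviation "y \<equiv> 1 - r ^ 4"

lemma eta_pos: "0 < \<eta>" and eta_lt: "\<eta> < pi / 3"
proof -
  have "0 < pi / (real k + 1)" by simp
  then show "0 < \<eta>" using lower by linarith
  have "pi / (real k - 1) \<le> pi / 3" using k4 by (intro divide_left_mono) auto
  then show "\<eta> < pi / 3" using upper by linarith
qed

lemmas cos_pos = absa_bounds(1)[OF eta_pos eta_lt]
lemmas r_gt_half = absa_bounds(3)[OF eta_pos eta_lt]
lemmas r_lt_1 = absa_bounds(4)[OF eta_pos eta_lt]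

lemma r_pos: "0 < r"
  using r_gt_half by linarith

lemma S1_pos: "0 < S 1"
  using absa_bounds(2)[OF eta_pos eta_lt] by (simp add: sm_1)

lemmas S_rec = sm_rec[OF cos_pos]
lemmas S_multiples = sm_multiples[OF cos_pos]

lemma eta_window: "pi < (real k + 1) * \<eta>" "(real k - 1) * \<eta> < pi"
  using lower upper k4 by (simp_all add: field_simps)

lemma eta_lt_quarter: "k \<noteq> 4 \<Longrightarrow> \<eta> < pi / 4"
proof -
  assume "k \<noteq> 4"
  then have "pi / (real k - 1) \<le> pi / 4" using k4 by (intro divide_left_mono) auto
  then show ?thesis using upper by linarith
qed

lemma r_sq_lt_half: "k \<noteq> 4 \<Longrightarrow> r\<^sup>2 < 1 / 2"
  using absa_sq_lt_half eta_pos eta_lt_quarter by blast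

lemma r_sq_lt_1: "r\<^sup>2 < 1"
  using r_pos r_lt_1 by (simp add: power_less_one_iff)

lemma r_power4_lt_half: "2 * r ^ 4 < 1"
proof (cases "k = 4")
  case True
  then show ?thesis using Phi_4_pos_iff(1)[OF eta_pos eta_lt] Phi_pos by simp
next
  case False
  have "r\<^sup>2 * r\<^sup>2 < 1 / 2 * 1"
    using r_sq_lt_half[OF False] r_sq_lt_1 by (intro mult_strict_mono) auto
  then show ?thesis by (simp add: power2_eq_square eval_nat_numeral)
qed

lemma y_pos: "0 < y"
  using r_power4_lt_half by simp

section \<open>Signs and sizes of the sines of multiples of the angle\<close>

lemma S_pos: "0 < n \<Longrightarrow> n < int k \<Longrightarrow> 0 < S n"
proof -
  assume n: "0 < n" "n < int k"
  have "of_int n * \<eta> \<le> (real k - 1) * \<eta>" using n eta_pos by (intro mult_right_mono) linarith+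
  then show ?thesis
    unfolding sm_def using n eta_pos eta_window(2) by (intro sin_gt_zero) (simp, linarith)
qed

lemma S_nonneg: "0 \<le> n \<Longrightarrow> n < int k \<Longrightarrow> 0 \<le> S n"
  using S_pos[of n] by (cases "n = 0") auto

lemma S_reflect: "S n = - sin (of_int n * \<eta> - pi)"
  by (simp add: sm_def)

text \<open>\<open>n * \<eta>\<close> lies strictly between \<open>pi\<close> and
  \<open>2 * pi\<close>; the upper bound uses k + 2 <= 2 (k - 1), true from k = 4 on.\<close>

lemma S_neg: "int k < n \<Longrightarrow> n \<le> int k + 2 \<Longrightarrow> S n < 0"
proof -
  assume n: "int k < n" "n \<le> int k + 2"
  have "(real k + 1) * \<eta> \<le> of_int n * \<eta>" using n eta_pos by (intro mult_right_mono) linarith+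
  moreover have "of_int n * \<eta> \<le> (2 * (real k - 1)) * \<eta>"
  proof (intro mult_right_mono)
    have "n \<le> 2 * (int k - 1)" using n k4 by presburger
    then have "real_of_int n \<le> of_int (2 * (int k - 1))" unfolding of_int_le_iff .
    then show "of_int n \<le> 2 * (real k - 1)" by simp
  qed (use eta_pos in simp)
  ultimately have "0 < sin (of_int n * \<eta> - pi)"
    using eta_window unfolding mult.assoc by (intro sin_gt_zero) linarith+
  then show ?thesis by (simp add: S_reflect)
qed

lemma S_k_gt: "- S 1 < S (int k)"
proof -
  have "real k * \<eta> - pi < \<eta>" "- \<eta> < real k * \<eta> - pi" using eta_window by (auto simp: algebra_simps)
  then have "sin (real k * \<eta> - pi) < sin \<eta>"
    using eta_pos eta_lt by (intro sin_monotone_2pi) auto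
  then show ?thesis by (simp add: S_reflect[of "int k"] sm_1)
qed

text \<open>As \<open>r * S 2 = S 1\<close>, a comparison of \<open>(k + 1) * \<eta> - pi\<close>
  with the larger angle \<open>2 * \<eta>\<close> suffices while the latter is below
  \<open>pi / 2\<close>. For k = 4 it may be larger, and a polynomial identity is used.\<close>

lemma S_k1_gt: "- S 1 < r ^ (k - 2) * S (int k + 1)"
proof (cases "k = 4")
  case True
  have "r\<^sup>2 * (r\<^sup>2 * S 5 + S 1) = r ^ 4 * S 5 + r\<^sup>2 * S 1"
    by (simp add: algebra_simps eval_nat_numeral)
  also have "\<dots> = (1 - r\<^sup>2)\<^sup>2 * S 1"
    unfolding S_multiples by (simp add: algebra_simps eval_nat_numeral)
  also have "\<dots> > 0" using r_sq_lt_1 S1_pos by auto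
  finally have "r\<^sup>2 * S 5 + S 1 > 0" using r_pos by (simp add: zero_less_mult_iff)
  then show ?thesis using True by simp
next
  case False
  define \<phi> where "\<phi> = (real k + 1) * \<eta> - pi"
  have "sin \<phi> < sin (2 * \<eta>)"
    using eta_window eta_lt_quarter[OF False]
    by (intro sin_monotone_2pi) (auto simp: \<phi>_def algebra_simps)
  then have 1: "sin \<phi> < S 2" by (simp add: sm_def)
  have 2: "0 < sin \<phi>"
    using eta_window eta_lt_quarter[OF False] by (intro sin_gt_zero) (auto simp: \<phi>_def algebra_simps)
  have "r ^ (k - 2) * sin \<phi> \<le> r ^ 1 * sin \<phi>"
    using 2 r_pos r_lt_1 k4 by (intro mult_right_mono power_decreasing) auto
  also have "\<dots> < S 1" using 1 r_pos S_multiples(1) by (simp flip: S_multiples(1))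
  finally show ?thesis using S_reflect[of "int k + 1"] by (simp add: \<phi>_def)
qed

text \<open>The analogous comparison is with \<open>3 * \<eta>\<close>, below \<open>pi / 2\<close>
  for \<open>\<eta> < pi / 6\<close>. For larger angles and k >= 5, \<open>1 / 2 \<le> S 1\<close>
  and \<open>r ^ (k - 1) \<le> r ^ 4 < 1 / 2\<close> suffice.\<close>

lemma S_k2_ge: "- S 1 \<le> r ^ (k - 1) * S (int k + 2)"
proof (cases "k = 4")
  case True
  have "r\<^sup>2 * (r ^ 3 * S 6 + S 1) = r ^ 5 * S 6 + r\<^sup>2 * S 1"
    by (simp add: algebra_simps eval_nat_numeral)
  also have "\<dots> = (3 * (r\<^sup>2 - 1 / 2)\<^sup>2 + 1 / 4) * S 1"
    unfolding S_multiples by (simp add: algebra_simps power2_eq_square eval_nat_numeral)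
  also have "\<dots> > 0" using S1_pos by (intro mult_pos_pos add_nonneg_pos) auto
  finally have "r ^ 3 * S 6 + S 1 > 0" using r_pos by (simp add: zero_less_mult_iff)
  then show ?thesis using True by simp
next
  case False
  show ?thesis
  proof (cases "\<eta> \<ge> pi / 6")
    case True
    have "sin (pi / 6) \<le> sin \<eta>" using True eta_lt by (intro sin_monotone_2pi_le) auto
    then have "1 / 2 \<le> S 1" by (simp add: sin_30 sm_1)
    moreover have "r ^ (k - 1) \<le> r ^ 4"
      using r_pos r_lt_1 k4 False by (intro power_decreasing) auto
    moreover have "- (r ^ (k - 1)) \<le> r ^ (k - 1) * S (int k + 2)"
      using mult_left_mono[of "-1" "S (int k + 2)" "r ^ (k - 1)"] r_pos by (simp add: sm_def)
    ultimately show ?thesis using r_power4_lt_half by linarith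
  next
    case small: False
    define \<phi> where "\<phi> = (real k + 2) * \<eta> - pi"
    have \<phi>: "0 < \<phi>" "\<phi> < 3 * \<eta>" using eta_window eta_pos by (auto simp: \<phi>_def algebra_simps)
    have "sin \<phi> \<le> sin (3 * \<eta>)"
      using \<phi> small by (intro sin_monotone_2pi_le) auto
    then have 1: "sin \<phi> \<le> S 3" by (simp add: sm_def)
    have 2: "0 \<le> sin \<phi>" using \<phi> small by (intro sin_ge_zero) auto
    have "r ^ (k - 1) * sin \<phi> \<le> r ^ 2 * sin \<phi>"
      using 2 r_pos r_lt_1 k4 by (intro mult_right_mono power_decreasing) auto
    also have "\<dots> \<le> r ^ 2 * S 3" using 1 by (intro mult_left_mono) auto
    also have "\<dots> \<le> S 1" unfolding S_multiples using S1_pos r_sq_lt_1 by (simp add: mult_le_cancel_right1)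
    finally show ?thesis using S_reflect[of "int k + 2"] by (simp add: \<phi>_def)
  qed
qed

text \<open>Past \<open>2 * pi\<close> the sine may be positive, but this happens only for k = 4,
  where \<open>7 * \<eta> - 2 * pi < \<eta>\<close>.\<close>

lemma S_k3_le: "r ^ (k + 2) * S (int k + 3) \<le> S 1"
proof (cases "(real k + 3) * \<eta> \<le> 2 * pi")
  case True
  have "sin ((real k + 3) * \<eta> - pi) \<ge> 0"
    using eta_window True eta_pos by (intro sin_ge_zero) (auto simp: algebra_simps)
  then have "S (int k + 3) \<le> 0" by (simp add: S_reflect)
  then have "r ^ (k + 2) * S (int k + 3) \<le> 0" using r_pos by (simp add: mult_le_0_iff)
  then show ?thesis using S1_pos by linarith
next
  case False
  have "k = 4"
  proof (rule ccontr)
    assume "k \<noteq> 4"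
    then have "(real k + 3) * \<eta> \<le> (2 * (real k - 1)) * \<eta>"
      using k4 eta_pos by (intro mult_right_mono) auto
    then show False using False eta_window unfolding mult.assoc by linarith
  qed
  then have \<theta>: "0 < 7 * \<eta> - 2 * pi" "7 * \<eta> - 2 * pi < \<eta>" using False eta_lt by auto
  then have "sin (7 * \<eta> - 2 * pi) \<le> sin \<eta>" using eta_lt by (intro sin_monotone_2pi_le) auto
  then have s: "S 7 \<le> S 1" by (simp add: sm_def sin_diff)
  have "r ^ 6 * S 7 \<le> r ^ 6 * S 1" using s r_pos by (intro mult_left_mono) auto
  also have "\<dots> \<le> S 1" using S1_pos r_pos r_lt_1 by (simp add: mult_le_cancel_right1 power_le_one)
  finally show ?thesis using \<open>k = 4\<close> by simp
qed

text \<open>Besides \<open>Phi k\<close> itself, the smaller indices come from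
  \<open>Phi_left_pos\<close> when k >= 5; its bound on \<open>r\<close> is not guaranteed for k =
  4, where they are computed directly.\<close>

lemma Phi_le_pos:
  assumes "1 \<le> n" "n \<le> k"
  shows "0 < y * S (int n - 1) - r ^ 3 * S (int n - 2) + r ^ n * S 1"
proof -
  have "Phi n \<eta> > 0"
  proof -
    consider "n = k" | "n = 1" | "n < k" "n \<ge> 2" "k \<noteq> 4" | "k = 4" "n = 2" | "k = 4" "n = 3"
      using assms k4 by linarith
    then show ?thesis
    proof cases
      case 1 then show ?thesis using Phi_pos by simp
    next
      case 2
      have "S (-1) = - S 1" by (rule sm_minus)
      then have "Phi 1 \<eta> = (r ^ 3 + r) * S 1" by (simp add: Phi_sm algebra_simps)
      then show ?thesis using 2 r_pos S1_pos by (simp add: add_pos_pos)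
    next
      case 3
      have "r\<^sup>2 + r ^ 4 \<le> 1" using r_sq_lt_half[OF 3(3)] r_power4_lt_half by linarith
      then show ?thesis
        using 3 cos_pos S1_pos by (intro Phi_left_pos) (auto intro!: S_nonneg simp: sm_1)
    next
      case 4
      then show ?thesis using y_pos S1_pos r_pos by (simp add: Phi_sm add_pos_pos)
    next
      case 5
      then show ?thesis using y_pos S_pos[of 2] by (simp add: Phi_sm)
    qed
  qed
  then show ?thesis by (simp add: Phi_sm)
qed

lemma Phi_Suc_k: "y * S (int k) - r ^ 3 * S (int k - 1) + r ^ (k + 1) * S 1 \<le> 0"
  using Phi_Suc_le Phi_sm[of "k + 1" \<eta>] by simp

text \<open>By \<open>sm_rec\<close> the left side drops by \<open>r ^ (m + 1) * S m\<close> from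
  \<open>m\<close> to \<open>m + 1\<close>, a nonnegative amount for \<open>m < k\<close>; from
  \<open>m = k\<close> on the sine is negative. This handles the later points of a spiral,
  \<open>spiral_backward\<close> the earlier ones.\<close>

lemma spiral_forward:
  assumes "2 \<le> m" "m \<le> k + 1"
  shows "r ^ m * S (int m + 1) < S 1"
proof (cases "m < k")
  case True
  from assms(1) True show ?thesis
  proof (induction m rule: dec_induct)
    case base
    have "(1 - r\<^sup>2) * S 1 < 1 * S 1" using S1_pos r_pos by (intro mult_strict_right_mono) auto
    then show ?case using S_multiples(2) by simp
  next
    case (step m)
    have "S (int m + 1) = r * (S (int m + 2) + S (int m))" using S_rec[of "int m + 1"] by (simp add: add.commute)
    then have "r ^ Suc m * S (int (Suc m) + 1) = r ^ m * S (int m + 1) - r ^ Suc m * S (int m)"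
      by (simp add: algebra_simps)
    moreover have "r ^ Suc m * S (int m) \<ge> 0" using r_pos step by (auto intro!: mult_nonneg_nonneg S_nonneg)
    ultimately show ?case using step by simp
  qed
next
  case False
  then have "S (int m + 1) < 0" using assms by (intro S_neg) auto
  then have "r ^ m * S (int m + 1) < 0" using r_pos by (simp add: mult_less_0_iff)
  then show ?thesis using S1_pos by linarith
qed

lemma spiral_backward:
  assumes "1 \<le> p" "p \<le> k"
  shows "0 < r ^ p * S 1 + S (int p - 1)"
  using assms r_pos S1_pos by (intro add_pos_nonneg S_nonneg) auto

text \<open>\<open>r ^ i * S (j - i)\<close> does not increase with \<open>i\<close>, by
  \<open>sm_rec\<close>; the smallest shift is therefore the critical one.\<close>

lemma shift_le:
  assumes "1 \<le> i" "i \<le> j" "j < k"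
  shows "r ^ i * S (int j - int i) \<le> r * S (int j - 1)"
  using assms(1,2)
proof (induction i rule: dec_induct)
  case base
  show ?case by simp
next
  case (step i)
  have "S (int j - int i) = r * (S (int j - int i + 1) + S (int j - int i - 1))" by (rule S_rec)
  moreover have "S (int j - int i + 1) \<ge> 0" using step assms by (intro S_nonneg) auto
  ultimately have "r * S (int j - int i - 1) \<le> S (int j - int i)"
    using r_pos by (simp add: algebra_simps)
  then have "r ^ i * (r * S (int j - int i - 1)) \<le> r ^ i * S (int j - int i)"
    using r_pos by (intro mult_left_mono) auto
  then show ?case using step by (simp add: algebra_simps)
qed

text \<open>Condition for \<open>w i\<close> at the edge leaving \<open>z j\<close>. For
  \<open>i \<le> j\<close>, \<open>shift_le\<close> reduces it to \<open>i = 1\<close>, that is to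
  \<open>Phi (j + 1) \<eta> > 0\<close>. For larger \<open>i\<close> the middle term helps, except
  possibly at \<open>j = 0\<close>, \<open>i = k\<close>.\<close>

lemma z_edge_w:
  assumes "j < k" "1 \<le> i" "i \<le> k"
  shows "0 < y * S (int j) - r ^ (i + 2) * S (int j - int i) + r ^ (j + 1) * S 1"
proof -
  consider "i \<le> j" | "i > j" "i - j < k" | "j = 0" "i = k" using assms by linarith
  then show ?thesis
  proof cases
    case 1
    have "r\<^sup>2 * (r ^ i * S (int j - int i)) \<le> r\<^sup>2 * (r * S (int j - 1))"
      using shift_le[of i j] assms 1 by (intro mult_left_mono) auto
    then have "r ^ (i + 2) * S (int j - int i) \<le> r ^ 3 * S (int j - 1)"
      by (simp add: power_add mult_ac eval_nat_numeral)
    moreover have "0 < y * S (int j) - r ^ 3 * S (int j - 1) + r ^ (j + 1) * S 1"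
      using Phi_le_pos[of "j + 1"] assms 1 by simp
    ultimately show ?thesis by linarith
  next
    case 2
    have "S (int i - int j) \<ge> 0" using 2 by (intro S_nonneg) auto
    then have "r ^ (i + 2) * S (int j - int i) \<le> 0"
      using sm_minus[of \<eta> "int i - int j"] r_pos by (simp add: mult_le_0_iff)
    moreover have "y * S (int j) \<ge> 0" using y_pos assms by (intro mult_nonneg_nonneg S_nonneg) auto
    moreover have "r ^ (j + 1) * S 1 > 0" using r_pos S1_pos by simp
    ultimately show ?thesis by linarith
  next
    case 3
    have "r ^ (k + 2) * (- S 1) \<le> r ^ (k + 2) * S (int k)"
      using S_k_gt r_pos by (intro mult_left_mono) auto
    moreover have "r ^ (k + 2) < r ^ 1" using r_pos r_lt_1 by (intro power_strict_decreasing) auto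
    then have "r ^ (k + 2) * S 1 < r ^ 1 * S 1" using S1_pos by (intro mult_strict_right_mono) auto
    ultimately show ?thesis using 3 by simp
  qed
qed

lemma less_4_cases: "j < (4::nat) \<Longrightarrow> j = 0 \<or> j = 1 \<or> j = 2 \<or> j = 3"
  by linarith

text \<open>Condition for \<open>w 0 = f2 (z 0)\<close>, which is not a vertex. For k = 4 the factor
  \<open>y - r ^ 2\<close> can be negative, so the four edges are treated separately.\<close>

lemma z_edge_w0:
  assumes "j < k"
  shows "0 \<le> (y - r\<^sup>2) * S (int j) + r ^ (j + 1) * S 1"
proof (cases "k = 4")
  case False
  then have "y - r\<^sup>2 \<ge> 0" using r_sq_lt_half r_power4_lt_half by force
  moreover have "S (int j) \<ge> 0" using assms by (intro S_nonneg) auto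
  ultimately show ?thesis using r_pos S1_pos by simp
next
  case True
  have 3: "r\<^sup>2 * ((y - r\<^sup>2) * S 3 + r ^ 4 * S 1) = ((y - r\<^sup>2) * (1 - r\<^sup>2) + r ^ 6) * S 1"
  proof -
    have "r\<^sup>2 * ((y - r\<^sup>2) * S 3 + r ^ 4 * S 1) = (y - r\<^sup>2) * (r\<^sup>2 * S 3) + r ^ 6 * S 1"
      by (simp add: algebra_simps eval_nat_numeral)
    then show ?thesis unfolding S_multiples by (simp add: algebra_simps)
  qed
  have "(y - r\<^sup>2) * (1 - r\<^sup>2) + r ^ 6 = 2 * (r\<^sup>2 + 1) * (r\<^sup>2 - 1 / 2)\<^sup>2 + 1 / 2 * (1 - r\<^sup>2)"
    by (simp add: algebra_simps power2_eq_square eval_nat_numeral)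
  also have "\<dots> \<ge> 0" using r_sq_lt_1 by (intro add_nonneg_nonneg mult_nonneg_nonneg) auto
  finally have "r\<^sup>2 * ((y - r\<^sup>2) * S 3 + r ^ 4 * S 1) \<ge> 0" using 3 S1_pos by simp
  then have j3: "(y - r\<^sup>2) * S 3 + r ^ 4 * S 1 \<ge> 0" using r_pos by (simp add: zero_le_mult_iff)
  have "(y - r\<^sup>2) * S 2 + r ^ 3 * S 1 = (1 - r\<^sup>2) * S 2"
    unfolding S_multiples(1)[symmetric] by (simp add: algebra_simps eval_nat_numeral)
  then have j2: "(y - r\<^sup>2) * S 2 + r ^ 3 * S 1 \<ge> 0" using S_pos[of 2] True r_sq_lt_1 by simp
  have "(y - r\<^sup>2) * S 1 + r ^ 2 * S 1 = y * S 1" by (simp add: algebra_simps)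
  then have j1: "(y - r\<^sup>2) * S 1 + r ^ 2 * S 1 \<ge> 0" using y_pos S1_pos by simp
  show ?thesis
    using less_4_cases[of j] assms True j1 j2 j3 r_pos S1_pos
    by (auto simp: numeral_2_eq_2 numeral_3_eq_3 eval_nat_numeral)
qed

text \<open>Condition for \<open>f2 b\<close>. For k >= 5, eliminating \<open>S (j + 1)\<close> by
  the recurrence leaves nonnegative coefficients when \<open>j > 0\<close>; k = 4 is again done edge
  by edge.\<close>

lemma z_edge_f2b:
  assumes "j < k"
  shows "0 \<le> y * (1 - r\<^sup>2) * S (int j) - r ^ 5 * S (int j + 1) + r ^ (j + 1) * S 1"
proof (cases "k = 4")
  case False
  show ?thesis
  proof (cases "j = 0")
    case True
    have "r ^ 5 * S 1 \<le> r ^ 1 * S 1"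
      using r_pos r_lt_1 S1_pos by (intro mult_right_mono power_decreasing) auto
    then show ?thesis using True by simp
  next
    case j: False
    have "S (int j) = r * (S (int j + 1) + S (int j - 1))" by (rule S_rec)
    then have "y * (1 - r\<^sup>2) * S (int j) - r ^ 5 * S (int j + 1)
        = (y * (1 - r\<^sup>2) - r ^ 4) * S (int j) + r ^ 5 * S (int j - 1)"
      by (simp add: algebra_simps eval_nat_numeral)
    moreover have "y * (1 - r\<^sup>2) - r ^ 4 \<ge> 0"
    proof -
      have x: "r\<^sup>2 \<le> 1 / 2" using r_sq_lt_half[OF False] by simp
      have x2: "r ^ 4 \<le> 1 / 4"
        using mult_mono[OF x x] by (simp add: power2_eq_square eval_nat_numeral)
      have "3 / 4 * (1 / 2) \<le> y * (1 - r\<^sup>2)" using x x2 by (intro mult_mono) auto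
      then show ?thesis using x2 by linarith
    qed
    moreover have "S (int j) \<ge> 0" "S (int j - 1) \<ge> 0" using j assms by (auto intro!: S_nonneg)
    ultimately show ?thesis using r_pos S1_pos by simp
  qed
next
  case True
  define x where "x = r\<^sup>2"
  have x: "0 < x" "x < 1" using r_sq_lt_1 r_pos by (auto simp: x_def)
  have y: "y = 1 - x\<^sup>2" by (simp add: x_def)
  have j0: "0 \<le> r * S 1 - r ^ 5 * S 1"
  proof -
    have "r ^ 5 * S 1 \<le> r ^ 1 * S 1"
      using r_pos r_lt_1 S1_pos by (intro mult_right_mono power_decreasing) auto
    then show ?thesis by simp
  qed
  have j1: "0 \<le> y * (1 - r\<^sup>2) * S 1 - r ^ 5 * S 2 + r ^ 2 * S 1"
  proof -
    have "y * (1 - r\<^sup>2) * S 1 - r ^ 5 * S 2 + r ^ 2 * S 1 = y * (1 - x) * S 1 - x\<^sup>2 * (r * S 2) + x * S 1"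
      by (simp add: x_def algebra_simps eval_nat_numeral)
    also have "\<dots> = (1 - 2 * x\<^sup>2 + x ^ 3) * S 1"
      unfolding S_multiples y by (simp add: algebra_simps eval_nat_numeral)
    also have "\<dots> \<ge> 0"
      using r_power4_lt_half x S1_pos by (intro mult_nonneg_nonneg add_nonneg_nonneg) (auto simp: x_def)
    finally show ?thesis .
  qed
  have j2: "0 \<le> y * (1 - r\<^sup>2) * S 2 - r ^ 5 * S 3 + r ^ 3 * S 1"
  proof -
    have "r * (y * (1 - r\<^sup>2) * S 2 - r ^ 5 * S 3 + r ^ 3 * S 1)
        = y * (1 - x) * (r * S 2) - x\<^sup>2 * (r\<^sup>2 * S 3) + x\<^sup>2 * S 1"
      by (simp add: x_def algebra_simps eval_nat_numeral)
    also have "\<dots> = (y * (1 - x) + x ^ 3) * S 1"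
      unfolding S_multiples by (simp add: x_def algebra_simps eval_nat_numeral)
    also have "\<dots> \<ge> 0"
      using y_pos x S1_pos by (intro mult_nonneg_nonneg add_nonneg_nonneg) auto
    finally show ?thesis using r_pos by (simp add: zero_le_mult_iff)
  qed
  have j3: "0 \<le> y * (1 - r\<^sup>2) * S 3 - r ^ 5 * S 4 + r ^ 4 * S 1"
  proof -
    have "r\<^sup>2 * (y * (1 - r\<^sup>2) * S 3 - r ^ 5 * S 4 + r ^ 4 * S 1)
        = y * (1 - x) * (r\<^sup>2 * S 3) - x\<^sup>2 * (r ^ 3 * S 4) + x ^ 3 * S 1"
      by (simp add: x_def algebra_simps eval_nat_numeral)
    also have "\<dots> = (y * (1 - x)\<^sup>2 - x\<^sup>2 * (1 - 2 * x) + x ^ 3) * S 1"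
      unfolding S_multiples by (simp add: x_def algebra_simps power2_eq_square)
    also have "y * (1 - x)\<^sup>2 - x\<^sup>2 * (1 - 2 * x) + x ^ 3
        = (x - 1 / 2)\<^sup>2 * (4 * x + 3) + 1 / 4 + x ^ 3 * (1 - x)"
      unfolding y by (simp add: algebra_simps power2_eq_square eval_nat_numeral)
    also have "((x - 1 / 2)\<^sup>2 * (4 * x + 3) + 1 / 4 + x ^ 3 * (1 - x)) * S 1 \<ge> 0"
      using x S1_pos by (intro mult_nonneg_nonneg add_nonneg_nonneg) auto
    finally show ?thesis using r_pos by (simp add: zero_le_mult_iff)
  qed
  show ?thesis
    using less_4_cases[of j] assms True j0 j1 j2 j3
    by (auto simp: numeral_2_eq_2 numeral_3_eq_3 eval_nat_numeral)
qed

text \<open>Up to a positive factor, \<open>supp_val j\<close> is the cross product of \<open>a\<^sup>j\<close> with the edge from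
  \<open>z\<^sub>k\<close> to \<open>w\<^sub>1\<close>.\<close>
definition supp_val :: "int \<Rightarrow> real" where
  "supp_val j = y * S j - r ^ 3 * S (j - 1) + r ^ (k + 1) * S (int k + 1 - j)"

lemma supp_val_interpolate:
  "supp_val j * S N = supp_val 0 * S (N - j) + supp_val N * S j"
proof -
  have 1: "S j * S N = S N * S j" by simp
  have 2: "S (j - 1) * S N = S (-1) * S (N - j) + S (N - 1) * S j"
    using sm_interpolate[of \<eta> "-1" j N] by (simp add: algebra_simps)
  have m: "S (int k + 1 - i) = - S (- (int k + 1) + i)" for i
    using sm_minus[of \<eta> "- (int k + 1) + i"] by (simp add: algebra_simps)
  have 3: "S (int k + 1 - j) * S N = S (int k + 1 - 0) * S (N - j) + S (int k + 1 - N) * S j"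
    unfolding m using sm_interpolate[of \<eta> "- (int k + 1)" j N] by (simp add: algebra_simps)
  have "supp_val j * S N = y * (S j * S N) - r ^ 3 * (S (j - 1) * S N)
      + r ^ (k + 1) * (S (int k + 1 - j) * S N)"
    by (simp add: supp_val_def algebra_simps)
  also have "\<dots> = y * (S N * S j) - r ^ 3 * (S (-1) * S (N - j) + S (N - 1) * S j)
      + r ^ (k + 1) * (S (int k + 1 - 0) * S (N - j) + S (int k + 1 - N) * S j)"
    unfolding 2 3 by simp
  also have "\<dots> = supp_val 0 * S (N - j) + supp_val N * S j"
    by (simp add: supp_val_def algebra_simps)
  finally show ?thesis .
qed

lemma S_k1_gt': "0 < r ^ 3 * S 1 + r ^ (k + 1) * S (int k + 1)"
proof -
  have "r ^ (k + 1) = r ^ 3 * r ^ (k - 2)" using k4 by (simp flip: power_add)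
  then have "r ^ 3 * S 1 + r ^ (k + 1) * S (int k + 1) = r ^ 3 * (S 1 + r ^ (k - 2) * S (int k + 1))"
    by (simp add: algebra_simps)
  also have "\<dots> > 0" using r_pos S_k1_gt by simp
  finally show ?thesis .
qed

text \<open>Positive at 0 by \<open>S_k1_gt'\<close> and at k - 1 by
  \<open>Phi k \<eta> > 0\<close>; in between, \<open>supp_val_interpolate\<close> has nonnegative
  weights.\<close>

lemma supp_val_pos:
  assumes "0 \<le> j" "j < int k"
  shows "supp_val j > 0"
proof -
  have m: "S (-1) = - S 1" by (rule sm_minus)
  have 0: "supp_val 0 > 0"
    using S_k1_gt' m by (simp add: supp_val_def)
  have "supp_val (int k - 1) = y * S (int k - 1) - r ^ 3 * S (int k - 2) + r ^ k * S 1"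
    unfolding supp_val_def by (simp flip: S_multiples(1))
  then have N: "supp_val (int k - 1) > 0"
    using Phi_le_pos[of k] k4 by simp
  have "supp_val j * S (int k - 1) > 0"
  proof (cases "j = 0")
    case True
    then show ?thesis using 0 S_pos[of "int k - 1"] k4 by simp
  next
    case False
    have "supp_val 0 * S (int k - 1 - j) \<ge> 0" using 0 assms by (intro mult_nonneg_nonneg S_nonneg) auto
    moreover have "supp_val (int k - 1) * S j > 0" using N assms False by (intro mult_pos_pos S_pos) auto
    ultimately show ?thesis unfolding supp_val_interpolate[of j] by linarith
  qed
  then show ?thesis using S_pos[of "int k - 1"] k4 by (simp add: zero_less_mult_iff)
qed

text \<open>The value is exactly \<open>Phi (k + 1) \<eta>\<close>. This sign change after k - 1 is
  what makes the spiral of vertices end at \<open>z k\<close>.\<close>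

lemma supp_val_k: "supp_val (int k) \<le> 0"
  using Phi_Suc_k by (simp add: supp_val_def)

lemma supp_val_minus1: "supp_val (-1) \<le> 0"
proof -
  have m: "S (-1) = - S 1" "S (-2) = - S 2" by (rule sm_minus)+
  have "supp_val (-1) = - y * S 1 + r\<^sup>2 * (r * S 2) + r ^ (k + 1) * S (int k + 2)"
    by (simp add: supp_val_def m algebra_simps eval_nat_numeral)
  then have e: "supp_val (-1) = - (1 - r\<^sup>2 - r ^ 4) * S 1 + r ^ (k + 1) * S (int k + 2)"
    unfolding S_multiples by (simp add: algebra_simps)
  show ?thesis
  proof (cases "k = 4")
    case True
    have "supp_val (-1) = - (1 - r\<^sup>2 - r ^ 4) * S 1 + r ^ 5 * S 6" using e True by simp
    also have "\<dots> = r\<^sup>2 * (4 * r\<^sup>2 - 3) * S 1"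
      unfolding S_multiples by (simp add: algebra_simps eval_nat_numeral)
    also have "\<dots> \<le> 0"
    proof -
      have "(r\<^sup>2)\<^sup>2 < (3 / 4)\<^sup>2" using r_power4_lt_half by (simp add: power2_eq_square eval_nat_numeral)
      then have "r\<^sup>2 < 3 / 4" by (rule power2_less_imp_less) simp
      then show ?thesis using S1_pos by (simp add: mult_le_0_iff)
    qed
    finally show ?thesis .
  next
    case False
    have "(1 - r\<^sup>2 - r ^ 4) * S 1 \<ge> 0"
      using r_sq_lt_half[OF False] r_power4_lt_half S1_pos by (intro mult_nonneg_nonneg) auto
    moreover have "r ^ (k + 1) * S (int k + 2) \<le> 0"
      using S_neg[of "int k + 2"] r_pos by (simp add: mult_le_0_iff)
    ultimately show ?thesis unfolding e by linarith
  qed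
qed

subsection \<open>Edges of the two spirals\<close>

abbreviation "a \<equiv> aa \<eta>"
abbreviation "c \<equiv> cc \<eta>"
abbreviation "z \<equiv> zz \<eta>"
abbreviation "w \<equiv> ww \<eta>"
abbreviation "b \<equiv> bb \<eta> 0"

lemma a_polar: "a = of_real r * cis (- \<eta>)"
  by (simp add: aa_def absa_def)

lemma cmod_a: "cmod a = r"
  using r_pos by (simp add: a_polar norm_mult)

text \<open>The real part of \<open>a\<close> is \<open>1 / 2\<close> for every angle. This is what
  makes differences of consecutive spiral points multiples of single powers of
  \<open>a\<close>.\<close>

lemma cnj_a: "cnj a = 1 - a"
proof -
  have "Re a = 1 / 2" using cos_pos by (simp add: a_polar absa_def)
  then show ?thesis by (simp add: complex_eq_iff)
qed

lemma a_cnj_a: "a * cnj a = of_real (r\<^sup>2)"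
  using complex_norm_square[of a] by (simp add: cmod_a)

text \<open>The bridge from geometry to trigonometry: cross products of spiral directions depend on
  the difference of exponents through \<open>sm\<close>.\<close>

lemma Im_cnj_pow_pow: "Im (cnj a ^ j * a ^ i) = r ^ (i + j) * S (int j - int i)"
proof -
  have "cnj a ^ j * a ^ i = of_real (r ^ (i + j)) * (cis (real j * \<eta>) * cis (- (real i * \<eta>)))"
    by (simp add: a_polar power_mult_distrib Complex.DeMoivre cis_cnj power_add mult_ac)
  also have "\<dots> = of_real (r ^ (i + j)) * cis (of_int (int j - int i) * \<eta>)"
    unfolding cis_mult by (simp add: algebra_simps)
  finally show ?thesis by (simp add: sm_def)
qed

lemma Im_a_pow: "Im (a ^ i) = - (r ^ i * S (int i))"
  using Im_cnj_pow_pow[of 0 i] by simp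

lemma Im_a: "Im a = - (r * S 1)"
  using Im_a_pow[of 1] by simp

lemma Im_cnj_pow: "Im (cnj a ^ j) = r ^ j * S (int j)"
  using Im_cnj_pow_pow[of j 0] by simp

lemma c_y: "c * y = 1" and c_pos: "c > 0"
  using y_pos by (auto simp: cc_def cmod_a)

text \<open>Gives a term without \<open>c\<close> the factor \<open>c\<close>, so that it can be
  pulled out of a whole cross product.\<close>

lemma c_expand: "t = c * (y * t)"
  using c_y by (simp flip: mult.assoc)

lemma z_eq: "z j = of_real c * a ^ Suc j"
  by (simp add: zz_def)

lemma w_eq: "w j = 1 - of_real (c * r\<^sup>2) * a ^ j"
  by (simp add: ww_def cmod_a)

lemma b_eq: "b = a + of_real (c * r ^ 4)"
  by (simp add: bb_def cmod_a)

lemma z_Suc_diff: "z (Suc j) - z j = - (of_real (c * r\<^sup>2) * a ^ j)"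
proof -
  have "z (Suc j) - z j = - (of_real c * a ^ j * (a * (1 - a)))"
    by (simp add: z_eq algebra_simps)
  then show ?thesis by (simp add: a_cnj_a flip: cnj_a)
qed

lemma w_Suc_diff: "w (Suc (Suc n)) - w (Suc n) = of_real (c * r ^ 4) * a ^ n"
proof -
  have "w (Suc (Suc n)) - w (Suc n) = of_real (c * r\<^sup>2) * a ^ n * (a * (1 - a))"
    by (simp add: w_eq algebra_simps)
  then show ?thesis by (simp add: a_cnj_a flip: cnj_a)
qed

lemma w_1_0_diff: "w 1 - w 0 = of_real (c * r\<^sup>2) * cnj a"
  by (simp add: w_eq cnj_a algebra_simps)

lemma c_r4: "c * r ^ 4 = c - 1"
  using c_y by (simp add: algebra_simps)

lemma z0_b_diff: "z 0 - b = - (of_real (c * r ^ 4) * cnj a)"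
  by (simp add: z_eq b_eq cnj_a c_r4 algebra_simps flip: of_real_mult of_real_power)

section \<open>Images of the vertices under the two maps\<close>

lemma f1_z: "f1 \<eta> (z j) = z (Suc j)"
  by (simp add: f1_def z_eq)

lemma f2_z: "f2 \<eta> (z j) = w j"
proof -
  have "cnj a * (of_real c * a ^ Suc j) = of_real c * a ^ j * (a * cnj a)" by (simp add: mult_ac)
  then show ?thesis by (simp add: f2_def z_eq w_eq a_cnj_a)
qed

lemma f1_w: "f1 \<eta> (w j) = w (Suc j) - cnj a"
  by (simp add: f1_def w_eq cnj_a algebra_simps)

lemma f2_f2: "f2 \<eta> (f2 \<eta> p) = a + (cnj a)\<^sup>2 * p"
  by (simp add: f2_def cnj_a algebra_simps power2_eq_square)

text \<open>With \<open>f2_z\<close> this shows that \<open>f2\<close> carries the edge from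
  \<open>z k\<close> to \<open>w 1\<close> to the edge from \<open>w k\<close> to
  \<open>b\<close>.\<close>

lemma f2_w1: "f2 \<eta> (w 1) = b"
proof -
  have "(cnj a)\<^sup>2 * z 1 = of_real c * (a * cnj a)\<^sup>2" by (simp add: z_eq power2_eq_square mult_ac)
  also have "\<dots> = of_real (c * r ^ 4)" unfolding a_cnj_a by (simp flip: of_real_power power_mult)
  finally show ?thesis using f2_f2[of "z 1"] by (simp add: f2_z b_eq)
qed

text \<open>A point of the segment between \<open>z 0\<close> and \<open>z j\<close>, hence in the
  polygon by convexity, without tests against edges. The same holds in \<open>f1_b\<close>.\<close>

lemma f2_w_Suc: "f2 \<eta> (w (Suc (Suc j))) = of_real (1 - r ^ 4) * z 0 + of_real (r ^ 4) * z j"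
proof -
  have "(cnj a)\<^sup>2 * z (Suc (Suc j)) = z j * (a * cnj a)\<^sup>2" by (simp add: z_eq power2_eq_square mult_ac)
  also have "\<dots> = of_real (r ^ 4) * z j" unfolding a_cnj_a by (simp flip: of_real_power power_mult)
  finally have "f2 \<eta> (w (Suc (Suc j))) = a + of_real (r ^ 4) * z j"
    using f2_f2[of "z (Suc (Suc j))"] by (simp add: f2_z)
  moreover have "of_real (1 - r ^ 4) * z 0 = of_real (c * y) * a" by (simp add: z_eq)
  then have "of_real (1 - r ^ 4) * z 0 = a" using c_y by simp
  ultimately show ?thesis by simp
qed

lemma f1_b: "f1 \<eta> b = of_real (1 - r ^ 4) * z 1 + of_real (r ^ 4) * z 0"
proof -
  have "of_real (1 - r ^ 4) * z 1 = of_real (c * y) * (a * a)" by (simp add: z_eq)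
  then have "of_real (1 - r ^ 4) * z 1 = a * a" unfolding c_y by simp
  moreover have "f1 \<eta> b = a * a + of_real (r ^ 4) * z 0" by (simp add: f1_def b_eq z_eq algebra_simps)
  ultimately show ?thesis by simp
qed

lemma f2_b: "f2 \<eta> b = of_real (1 - r\<^sup>2) - of_real (c * r ^ 4) * cnj a"
proof -
  have "f2 \<eta> b = 1 - a * cnj a - of_real (c * r ^ 4) * cnj a"
    by (simp add: f2_def b_eq algebra_simps)
  then show ?thesis unfolding a_cnj_a by simp
qed

section \<open>Cross products with the edge directions\<close>

lemma Im_of_real_mult: "Im (u * (of_real t * v)) = t * Im (u * v)"
  by (simp add: algebra_simps)

lemma Im_cnj_z: "Im (cnj a ^ j * z i) = c * r ^ (i + j + 1) * S (int j - int i - 1)"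
  unfolding z_eq Im_of_real_mult Im_cnj_pow_pow by (simp add: algebra_simps)

lemma Im_cnj_w: "Im (cnj a ^ j * w i) = c * r ^ j * (y * S (int j) - r ^ (i + 2) * S (int j - int i))"
proof -
  have "Im (cnj a ^ j * w i) = r ^ j * S (int j) - c * r\<^sup>2 * (r ^ (i + j) * S (int j - int i))"
    unfolding w_eq right_diff_distrib minus_complex.sel Im_of_real_mult Im_cnj_pow_pow
    by (simp add: Im_cnj_pow)
  also have "r ^ j * S (int j) = c * (y * (r ^ j * S (int j)))" by (rule c_expand)
  finally show ?thesis by (simp only: power_add) (simp add: right_diff_distrib mult_ac)
qed

lemma Im_cnj_cnj: "Im (cnj a ^ j * cnj a) = r ^ (j + 1) * S (int j + 1)"
  using Im_cnj_pow[of "Suc j"] by (simp add: mult_ac add.commute)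

lemma Im_cnj_a: "Im (cnj a ^ j * a) = r ^ (j + 1) * S (int j - 1)"
  using Im_cnj_pow_pow[of j 1] by (simp add: mult_ac add.commute)

lemma Im_cnj_b: "Im (cnj a ^ j * b) = c * r ^ (j + 1) * (y * S (int j - 1) + r ^ 3 * S (int j))"
proof -
  have "Im (cnj a ^ j * b) = Im (cnj a ^ j * a) + c * r ^ 4 * Im (cnj a ^ j)"
    using Im_of_real_mult[of "cnj a ^ j" "c * r ^ 4" 1] by (simp only: b_eq distrib_left plus_complex.sel mult_1_right)
  also have "\<dots> = r ^ (j + 1) * S (int j - 1) + c * r ^ 4 * (r ^ j * S (int j))"
    unfolding Im_cnj_a Im_cnj_pow ..
  also have "r ^ (j + 1) * S (int j - 1) = c * (y * (r ^ (j + 1) * S (int j - 1)))" by (rule c_expand)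
  finally show ?thesis by (simp add: algebra_simps eval_nat_numeral)
qed

lemma Im_cnj_f2b: "Im (cnj a ^ j * f2 \<eta> b) =
    c * r ^ j * (y * (1 - r\<^sup>2) * S (int j) - r ^ 5 * S (int j + 1))"
proof -
  have "Im (cnj a ^ j * f2 \<eta> b) = (1 - r\<^sup>2) * Im (cnj a ^ j) - c * r ^ 4 * Im (cnj a ^ j * cnj a)"
    unfolding f2_b right_diff_distrib minus_complex.sel Im_of_real_mult by simp
  also have "\<dots> = (1 - r\<^sup>2) * (r ^ j * S (int j)) - c * r ^ 4 * (r ^ (j + 1) * S (int j + 1))"
    unfolding Im_cnj_cnj Im_cnj_pow ..
  also have "(1 - r\<^sup>2) * (r ^ j * S (int j)) = c * (y * ((1 - r\<^sup>2) * (r ^ j * S (int j))))" by (rule c_expand)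
  finally show ?thesis by (simp add: algebra_simps eval_nat_numeral)
qed

lemma S_m1: "S (-1) = - S 1" "S (-2) = - S 2"
  by (rule sm_minus)+

lemma turn_z: "turn (z j) (z (Suc j)) p = - (c * r\<^sup>2) * (Im (cnj a ^ j * p) + c * r ^ (2 * j + 1) * S 1)"
proof -
  have "turn (z j) (z (Suc j)) p = - (c * r\<^sup>2) * (Im (cnj a ^ j * p) - Im (cnj a ^ j * z j))"
    unfolding turn_def z_Suc_diff by (simp add: algebra_simps)
  also have "Im (cnj a ^ j * z j) = - (c * r ^ (2 * j + 1) * S 1)"
    unfolding Im_cnj_z by (simp add: S_m1 mult_2)
  finally show ?thesis by simp
qed

lemma turn_b: "turn b (z 0) p = - (c * r ^ 4) * (Im (a * p) + c * r * S 1)"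
proof -
  have "turn b (z 0) p = - (c * r ^ 4) * (Im (a * p) - Im (a * z 0))"
    unfolding turn_eq_translate[of b] z0_b_diff by (simp add: algebra_simps)
  also have "Im (a * z 0) = c * Im (a ^ 2)"
    unfolding z_eq Im_of_real_mult by (simp only: power2_eq_square power_Suc power_0 mult_1_right)
  also have "\<dots> = - (c * r * (r * S 2))" unfolding Im_a_pow by (simp add: power2_eq_square)
  also have "\<dots> = - (c * r * S 1)" unfolding S_multiples ..
  finally show ?thesis by simp
qed

lemma turn_w: "turn (w (Suc n)) (w (Suc (Suc n))) p =
    (c * r ^ 4) * (Im (cnj a ^ n * p) - c * r ^ n * (y * S (int n) + r ^ (n + 3) * S 1))"
proof -
  have "turn (w (Suc n)) (w (Suc (Suc n))) p = (c * r ^ 4) * (Im (cnj a ^ n * p) - Im (cnj a ^ n * w (Suc n)))"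
    unfolding turn_def w_Suc_diff by (simp add: algebra_simps)
  also have "Im (cnj a ^ n * w (Suc n)) = c * r ^ n * (y * S (int n) + r ^ (n + 3) * S 1)"
    unfolding Im_cnj_w by (simp add: S_m1 eval_nat_numeral)
  finally show ?thesis .
qed

lemma turn_f2: "turn (f2 \<eta> p) (f2 \<eta> q) (f2 \<eta> s) = r\<^sup>2 * turn p q s"
proof -
  have "cnj (f2 \<eta> q - f2 \<eta> p) * (f2 \<eta> s - f2 \<eta> p) = (a * cnj a) * (cnj (q - p) * (s - p))"
    by (simp add: f2_def algebra_simps)
  then show ?thesis unfolding turn_def a_cnj_a by simp
qed

text \<open>Condition for \<open>w i\<close> at the edge from \<open>b\<close> to
  \<open>z 0\<close>. The index k + 1 is included for the sake of \<open>f1 (w k)\<close>, and rests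
  on \<open>S_k2_ge\<close>.\<close>

lemma b_edge_w_nonneg:
  assumes "i \<le> k + 1"
  shows "0 \<le> r ^ 4 * S 1 + r ^ (i + 2) * S (int i + 1)"
    and "i \<le> k \<Longrightarrow> 0 < r ^ 4 * S 1 + r ^ (i + 2) * S (int i + 1)"
proof -
  have r4: "r ^ 4 * S 1 > 0" using r_pos S1_pos by simp
  have strict: "0 < r ^ 4 * S 1 + r ^ (i + 2) * S (int i + 1)" if "i \<le> k"
  proof -
    consider "i + 1 < k" | "i + 1 = k" | "i = k" using \<open>i \<le> k\<close> by linarith
    then show ?thesis
    proof cases
      case 1
      then have "S (int i + 1) \<ge> 0" by (intro S_nonneg) auto
      then show ?thesis using r4 r_pos by (intro add_pos_nonneg) auto
    next
      case 2
      have "r ^ (i + 2) * (- S 1) < r ^ (i + 2) * S (int k)"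
        using r_pos S_k_gt by (intro mult_strict_left_mono) auto
      moreover have "r ^ (i + 2) * S 1 \<le> r ^ 4 * S 1"
        using r_pos r_lt_1 S1_pos 2 k4 by (intro mult_right_mono power_decreasing) auto
      moreover have "int i + 1 = int k" using 2 by simp
      ultimately show ?thesis by simp
    next
      case 3
      have "r ^ 4 * S 1 + r ^ (k + 2) * S (int k + 1) = r * (r ^ 3 * S 1 + r ^ (k + 1) * S (int k + 1))"
        by (simp add: algebra_simps eval_nat_numeral)
      then show ?thesis using 3 S_k1_gt' r_pos by simp
    qed
  qed
  then show "i \<le> k \<Longrightarrow> 0 < r ^ 4 * S 1 + r ^ (i + 2) * S (int i + 1)" .
  show "0 \<le> r ^ 4 * S 1 + r ^ (i + 2) * S (int i + 1)"
  proof (cases "i \<le> k")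
    case True
    then show ?thesis using strict by simp
  next
    case False
    then have i: "i = k + 1" using assms by simp
    have "r ^ (k + 3) = r ^ 4 * r ^ (k - 1)" using k4 by (simp add: add.commute flip: power_add)
    then have "r ^ 4 * S 1 + r ^ (k + 3) * S (int k + 2) = r ^ 4 * (S 1 + r ^ (k - 1) * S (int k + 2))"
      by (simp add: algebra_simps)
    also have "\<dots> \<ge> 0" using r_pos S_k2_ge by simp
    finally show ?thesis using i by (simp add: add.commute eval_nat_numeral)
  qed
qed

text \<open>Condition for \<open>z i\<close> at the edge leaving \<open>w (n + 1)\<close>. For
  \<open>i + 2 \<le> n\<close> it reduces to \<open>Phi (n + 2) \<eta> > 0\<close>; otherwise the
  middle term helps, until its sine index reaches k or k + 1, where \<open>S_k_gt\<close> and
  \<open>S_k1_gt'\<close> take over.\<close>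

lemma w_edge_z:
  assumes "n + 2 \<le> k" "i \<le> k"
  shows "0 < y * S (int n) - r ^ (i + 1) * S (int n - int i - 1) + r ^ (n + 3) * S 1"
proof -
  have neg: "S (int n - int i - 1) = - S (int i + 1 - int n)"
    using sm_minus[of \<eta> "int i + 1 - int n"] by (simp add: algebra_simps)
  have yn: "y * S (int n) \<ge> 0" using y_pos assms by (intro mult_nonneg_nonneg S_nonneg) auto
  have rn: "r ^ (n + 3) * S 1 > 0" using r_pos S1_pos by simp
  consider "i + 2 \<le> n" | "n \<le> i + 1" "i + 1 < n + k" | "i + 1 = n + k" | "n = 0" "i = k"
    using assms by linarith
  then show ?thesis
  proof cases
    case 1
    have "r ^ (i + 1) * S (int n - int (i + 1)) \<le> r * S (int n - 1)"
      using 1 assms by (intro shift_le) auto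
    moreover have "S (int n) = r * (S (int n + 1) + S (int n - 1))" by (rule S_rec)
    then have "y * S (int n) - r * S (int n - 1) + r ^ (n + 3) * S 1
        = r * (r ^ 4 * S (int n + 1) + (y * S (int n + 1) - r ^ 3 * S (int n) + r ^ (n + 2) * S 1))"
      by (simp add: algebra_simps eval_nat_numeral)
    moreover have "0 < y * S (int n + 1) - r ^ 3 * S (int n) + r ^ (n + 2) * S 1"
      using Phi_le_pos[of "n + 2"] assms by (simp add: add.commute)
    moreover have "r ^ 4 * S (int n + 1) \<ge> 0"
      using r_pos assms by (intro mult_nonneg_nonneg S_nonneg) auto
    ultimately show ?thesis
      using r_pos by (smt (verit) mult_pos_pos of_nat_1 of_nat_add diff_diff_eq)
  next
    case 2
    then have "r ^ (i + 1) * S (int i + 1 - int n) \<ge> 0" using r_pos by (intro mult_nonneg_nonneg S_nonneg) auto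
    then show ?thesis unfolding neg using yn rn by simp
  next
    case 3
    then have n: "n = 0 \<and> i + 1 = k \<or> n = 1 \<and> i = k" using assms by linarith
    have "int i + 1 - int n = int k" using 3 by simp
    then have "r ^ (i + 1) * S (int n - int i - 1) \<le> r ^ (i + 1) * S 1"
      unfolding neg using S_k_gt r_pos by (intro mult_left_mono) auto
    moreover have "r ^ (i + 1) * S 1 < y * S (int n) + r ^ (n + 3) * S 1"
      using n
    proof
      assume n: "n = 0 \<and> i + 1 = k"
      have "r ^ (i + 1) * S 1 < r ^ 3 * S 1"
        using n k4 r_pos r_lt_1 S1_pos by (intro mult_strict_right_mono power_strict_decreasing) auto
      moreover have "n = 0" using n by simp
      ultimately show ?thesis by simp
    next
      assume n: "n = 1 \<and> i = k"
      have "r ^ (i + 1) * S 1 < 1 * S 1"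
        using n power_Suc_less_one[OF r_pos r_lt_1, of k] S1_pos by (intro mult_strict_right_mono) auto
      then show ?thesis using n by (simp add: algebra_simps eval_nat_numeral)
    qed
    ultimately show ?thesis by linarith
  next
    case 4
    then show ?thesis using S_k1_gt' neg by simp
  qed
qed

lemma Im_a_z: "Im (a * z i) = - (c * r * (r ^ (i + 1) * S (int i + 2)))"
proof -
  have "Im (a * z i) = c * Im (a ^ (i + 2))"
    unfolding z_eq Im_of_real_mult by simp
  then show ?thesis unfolding Im_a_pow by (simp add: add.commute)
qed

lemma Im_a_w: "Im (a * w i) = c * r * (r ^ (i + 2) * S (int i + 1) - y * S 1)"
proof -
  have "Im (a * w i) = Im a - c * r\<^sup>2 * Im (a ^ (i + 1))"
    unfolding w_eq right_diff_distrib minus_complex.sel Im_of_real_mult by simp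
  also have "\<dots> = - (r * S 1) + c * r\<^sup>2 * (r ^ (i + 1) * S (int i + 1))"
    unfolding Im_a Im_a_pow by (simp add: add.commute)
  also have "r * S 1 = c * (y * (r * S 1))" by (rule c_expand)
  finally show ?thesis by (simp add: algebra_simps eval_nat_numeral)
qed

section \<open>Points to the right of the spiral edges\<close>

lemma pos_coeffs: "0 < c * r\<^sup>2" "0 < c * r ^ 4" "0 < c * r"
  using c_pos r_pos by auto

lemma turn_b_z:
  assumes "1 \<le> i" "i \<le> k"
  shows "turn b (z 0) (z i) < 0"
proof -
  have "r ^ (i + 1) * S (int i + 2) < S 1"
    using spiral_forward[of "i + 1"] assms by (simp add: add.commute)
  then have "0 < c * r * (S 1 - r ^ (i + 1) * S (int i + 2))"
    using pos_coeffs by simp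
  then have "0 < Im (a * z i) + c * r * S 1" unfolding Im_a_z by (simp add: algebra_simps)
  then show ?thesis unfolding turn_b using pos_coeffs(2) by (simp add: mult_neg_pos)
qed

lemma Im_a_w': "Im (a * w i) + c * r * S 1 = c * r * (r ^ 4 * S 1 + r ^ (i + 2) * S (int i + 1))"
  unfolding Im_a_w by (simp add: algebra_simps)

lemma turn_b_w:
  assumes "i \<le> k"
  shows "turn b (z 0) (w i) < 0"
  unfolding turn_b Im_a_w'
  using b_edge_w_nonneg(2)[of i] assms c_pos r_pos by (intro mult_neg_pos mult_pos_pos) auto

text \<open>\<open>f1 (w i)\<close> is \<open>w (i + 1)\<close> shifted by \<open>- cnj a\<close>,
  which is parallel to this edge, so the shift leaves the turn unchanged.\<close>

lemma turn_b_f1w: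
  assumes "i \<le> k"
  shows "turn b (z 0) (f1 \<eta> (w i)) \<le> 0"
proof -
  have "Im (a * f1 \<eta> (w i)) = Im (a * w (Suc i)) - Im (a * cnj a)"
    unfolding f1_w by (simp only: right_diff_distrib minus_complex.sel)
  then have "Im (a * f1 \<eta> (w i)) = Im (a * w (Suc i))" unfolding a_cnj_a by simp
  then show ?thesis
    unfolding turn_b using Im_a_w'[of "Suc i"] b_edge_w_nonneg(1)[of "Suc i"] assms pos_coeffs
    by (simp add: mult_le_0_iff)
qed

lemma turn_b_f2b: "turn b (z 0) (f2 \<eta> b) \<le> 0"
proof -
  have "Im (a * f2 \<eta> b) = (1 - r\<^sup>2) * Im a - c * r ^ 4 * Im (a * cnj a)"
    unfolding f2_b right_diff_distrib minus_complex.sel Im_of_real_mult by simp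
  then have "Im (a * f2 \<eta> b) + c * r * S 1 = (r\<^sup>2 + (c - 1)) * (r * S 1)"
    unfolding a_cnj_a Im_a by (simp add: algebra_simps)
  moreover have "c - 1 \<ge> 0" using c_r4 pos_coeffs(2) by simp
  ultimately show ?thesis unfolding turn_b using pos_coeffs(2) r_pos S1_pos by (simp add: mult_le_0_iff)
qed

lemma neg_mult_iff:
  fixes C t :: real
  assumes "0 < C"
  shows "- C * t < 0 \<longleftrightarrow> 0 < t" "- C * t \<le> 0 \<longleftrightarrow> 0 \<le> t"
    "C * (s - t) < 0 \<longleftrightarrow> s < t" "C * (s - t) \<le> 0 \<longleftrightarrow> s \<le> t"
  using assms by (auto simp: mult_less_0_iff mult_le_0_iff zero_less_mult_iff zero_le_mult_iff)

lemma turn_z_neg_iff: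
  "turn (z j) (z (Suc j)) p < 0 \<longleftrightarrow> 0 < Im (cnj a ^ j * p) + c * r ^ (2 * j + 1) * S 1"
  "turn (z j) (z (Suc j)) p \<le> 0 \<longleftrightarrow> 0 \<le> Im (cnj a ^ j * p) + c * r ^ (2 * j + 1) * S 1"
  unfolding turn_z by (rule neg_mult_iff[OF pos_coeffs(1)])+

lemma turn_z_z:
  assumes "j < k" "i \<le> k" "i \<noteq> j" "i \<noteq> Suc j"
  shows "turn (z j) (z (Suc j)) (z i) < 0"
proof -
  consider m where "i = j + m" "2 \<le> m" "m \<le> k" | p where "j = i + p" "1 \<le> p" "p \<le> k"
  proof (cases "i < j")
    case True
    then show thesis using assms that(2)[of "j - i"] by auto
  next
    case False
    then show thesis using assms that(1)[of "i - j"] by auto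
  qed
  then show ?thesis
  proof cases
    case 1
    have "int j - int i - 1 = - (int m + 1)" using 1 by simp
    then have "S (int j - int i - 1) = - S (int m + 1)" by (simp only: sm_minus)
    then have "Im (cnj a ^ j * z i) + c * r ^ (2 * j + 1) * S 1 = c * r ^ (2 * j + 1) * (S 1 - r ^ m * S (int m + 1))"
      unfolding Im_cnj_z 1 by (simp add: algebra_simps power_add mult_2 mult_2_right)
    also have "\<dots> > 0" using spiral_forward[of m] 1 c_pos r_pos by simp
    finally show ?thesis unfolding turn_z_neg_iff .
  next
    case 2
    have "Im (cnj a ^ j * z i) + c * r ^ (2 * j + 1) * S 1 = c * r ^ (i + j + 1) * (r ^ p * S 1 + S (int p - 1))"
      unfolding Im_cnj_z 2 by (simp add: algebra_simps power_add mult_2 mult_2_right)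
    also have "\<dots> > 0" using spiral_backward[of p] 2 c_pos r_pos by simp
    finally show ?thesis unfolding turn_z_neg_iff .
  qed
qed

lemma Im_cnj_w': "Im (cnj a ^ j * w i) + c * r ^ (2 * j + 1) * S 1 =
    c * r ^ j * (y * S (int j) - r ^ (i + 2) * S (int j - int i) + r ^ (j + 1) * S 1)"
  unfolding Im_cnj_w by (simp add: algebra_simps power_add mult_2 mult_2_right)

lemma turn_z_w:
  assumes "j < k" "1 \<le> i" "i \<le> k"
  shows "turn (z j) (z (Suc j)) (w i) < 0"
  unfolding turn_z_neg_iff Im_cnj_w' using z_edge_w[OF assms] c_pos r_pos by simp

lemma turn_z_w0:
  assumes "j < k"
  shows "turn (z j) (z (Suc j)) (w 0) \<le> 0"
proof -
  have "Im (cnj a ^ j * w 0) + c * r ^ (2 * j + 1) * S 1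
      = c * r ^ j * ((y - r\<^sup>2) * S (int j) + r ^ (j + 1) * S 1)"
    unfolding Im_cnj_w' by (simp add: algebra_simps power2_eq_square)
  also have "\<dots> \<ge> 0" using z_edge_w0[OF assms] c_pos r_pos by simp
  finally show ?thesis unfolding turn_z_neg_iff .
qed

lemma turn_z_b:
  assumes "j < k"
  shows "turn (z j) (z (Suc j)) b < 0"
proof -
  have "Im (cnj a ^ j * b) + c * r ^ (2 * j + 1) * S 1
      = c * r ^ (j + 1) * (y * S (int j - 1) + r ^ 3 * S (int j) + r ^ j * S 1)"
    unfolding Im_cnj_b by (simp add: algebra_simps power_add mult_2 mult_2_right)
  moreover have "0 < y * S (int j - 1) + r ^ 3 * S (int j) + r ^ j * S 1"
  proof (cases "j = 0")
    case True
    have "y * S (-1) + S 1 = r ^ 4 * S 1" by (simp add: S_m1 algebra_simps)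
    then show ?thesis using True r_pos S1_pos by simp
  next
    case False
    then have "S (int j - 1) \<ge> 0" "S (int j) \<ge> 0" using assms by (auto intro!: S_nonneg)
    then show ?thesis using y_pos r_pos S1_pos by (intro add_nonneg_pos) auto
  qed
  ultimately show ?thesis unfolding turn_z_neg_iff using c_pos r_pos by simp
qed

lemma Im_of_real_times: "Im (of_real t * v) = t * Im v"
  by simp

text \<open>As \<open>a * cnj a = r ^ 2\<close>, the claim for \<open>j = n + 1\<close> is that for
  \<open>w i\<close> at the edge leaving \<open>z n\<close>, scaled by \<open>r ^ 2\<close>. For
  \<open>j = 0\<close> it is the condition for \<open>w i\<close> at the edge from \<open>b\<close>
  to \<open>z 0\<close>.\<close>

lemma turn_z_f1w:
  assumes "j < k" "1 \<le> i" "i \<le> k"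
  shows "turn (z j) (z (Suc j)) (f1 \<eta> (w i)) \<le> 0"
proof (cases j)
  case 0
  have "0 \<le> Im (a * w i) + c * r * S 1"
    unfolding Im_a_w' using b_edge_w_nonneg(1)[of i] assms pos_coeffs by simp
  then show ?thesis unfolding turn_z_neg_iff using 0 by (simp add: f1_def)
next
  case (Suc n)
  have "cnj a ^ Suc n * (a * w i) = (a * cnj a) * (cnj a ^ n * w i)" by (simp add: mult_ac)
  then have "Im (cnj a ^ j * f1 \<eta> (w i)) = r\<^sup>2 * Im (cnj a ^ n * w i)"
    unfolding a_cnj_a Suc f1_def by (simp only: Im_of_real_times)
  then have "Im (cnj a ^ j * f1 \<eta> (w i)) + c * r ^ (2 * j + 1) * S 1
      = r\<^sup>2 * (Im (cnj a ^ n * w i) + c * r ^ (2 * n + 1) * S 1)"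
    unfolding Suc by (simp add: algebra_simps eval_nat_numeral)
  moreover have "0 < Im (cnj a ^ n * w i) + c * r ^ (2 * n + 1) * S 1"
    using turn_z_w[of n i] assms Suc unfolding turn_z_neg_iff by simp
  ultimately show ?thesis unfolding turn_z_neg_iff by simp
qed

lemma turn_z_f2b:
  assumes "j < k"
  shows "turn (z j) (z (Suc j)) (f2 \<eta> b) \<le> 0"
proof -
  have "Im (cnj a ^ j * f2 \<eta> b) + c * r ^ (2 * j + 1) * S 1
      = c * r ^ j * (y * (1 - r\<^sup>2) * S (int j) - r ^ 5 * S (int j + 1) + r ^ (j + 1) * S 1)"
    unfolding Im_cnj_f2b by (simp add: algebra_simps power_add mult_2 mult_2_right)
  also have "\<dots> \<ge> 0" using z_edge_f2b[OF assms] c_pos r_pos by simp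
  finally show ?thesis unfolding turn_z_neg_iff .
qed

lemma turn_w_neg_iff:
  "turn (w (Suc n)) (w (Suc (Suc n))) p < 0 \<longleftrightarrow>
     Im (cnj a ^ n * p) < c * r ^ n * (y * S (int n) + r ^ (n + 3) * S 1)"
  "turn (w (Suc n)) (w (Suc (Suc n))) p \<le> 0 \<longleftrightarrow>
     Im (cnj a ^ n * p) \<le> c * r ^ n * (y * S (int n) + r ^ (n + 3) * S 1)"
  unfolding turn_w by (rule neg_mult_iff[OF pos_coeffs(2)])+

lemma turn_w_w:
  assumes "n + 2 \<le> k" "i \<le> k + 1" "i \<noteq> Suc n" "i \<noteq> Suc (Suc n)"
  shows "turn (w (Suc n)) (w (Suc (Suc n))) (w i) < 0"
proof -
  have "0 < r ^ (i + 2) * S (int n - int i) + r ^ (n + 3) * S 1"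
  proof (cases "i \<le> n")
    case True
    define p where "p = n + 1 - i"
    have p: "n = i + p - 1" "1 \<le> p" "p \<le> k" using True assms by (auto simp: p_def)
    have "r ^ (n + 3) = r ^ (i + 2) * r ^ p" using p by (simp flip: power_add)
    moreover have "int n - int i = int p - 1" using p by simp
    ultimately have "r ^ (i + 2) * S (int n - int i) + r ^ (n + 3) * S 1 = r ^ (i + 2) * (r ^ p * S 1 + S (int p - 1))"
      by (simp only: distrib_left mult.assoc add.commute)
    then show ?thesis using spiral_backward[OF p(2,3)] r_pos by simp
  next
    case False
    define m where "m = i - n - 1"
    have m: "i = n + m + 1" "2 \<le> m" "m \<le> k + 1" using False assms by (auto simp: m_def)
    have "int n - int i = - (int m + 1)" using m by simp
    then have "S (int n - int i) = - S (int m + 1)" by (simp only: sm_minus)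
    moreover have "r ^ (i + 2) = r ^ (n + 3) * r ^ m" using m by (simp add: power_add eval_nat_numeral)
    ultimately have "r ^ (i + 2) * S (int n - int i) + r ^ (n + 3) * S 1 = r ^ (n + 3) * (S 1 - r ^ m * S (int m + 1))"
      by (simp add: algebra_simps)
    then show ?thesis using spiral_forward[OF m(2,3)] r_pos by simp
  qed
  then have "c * r ^ n * (y * S (int n) - r ^ (i + 2) * S (int n - int i))
      < c * r ^ n * (y * S (int n) + r ^ (n + 3) * S 1)"
    using c_pos r_pos by (intro mult_strict_left_mono) auto
  then show ?thesis unfolding turn_w_neg_iff Im_cnj_w .
qed

lemma turn_w_f1w:
  assumes "n + 2 \<le> k" "i \<le> k"
  shows "turn (w (Suc n)) (w (Suc (Suc n))) (f1 \<eta> (w i)) \<le> 0"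
proof -
  have "turn (w (Suc n)) (w (Suc (Suc n))) (w (Suc i)) \<le> 0"
    using turn_w_w[of n "Suc i"] assms by (cases "i = n \<or> i = Suc n") auto
  moreover have "Im (cnj a ^ n * f1 \<eta> (w i)) = Im (cnj a ^ n * w (Suc i)) - r ^ (n + 1) * S (int n + 1)"
    unfolding f1_w right_diff_distrib minus_complex.sel Im_cnj_cnj ..
  moreover have "0 \<le> r ^ (n + 1) * S (int n + 1)"
    using r_pos assms by (intro mult_nonneg_nonneg S_nonneg) auto
  ultimately show ?thesis unfolding turn_w_neg_iff by linarith
qed

lemma turn_w_z:
  assumes "n + 2 \<le> k" "i \<le> k"
  shows "turn (w (Suc n)) (w (Suc (Suc n))) (z i) < 0"
proof -
  have "0 < c * r ^ n * (y * S (int n) - r ^ (i + 1) * S (int n - int i - 1) + r ^ (n + 3) * S 1)"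
    using w_edge_z[OF assms] c_pos r_pos by simp
  then show ?thesis unfolding turn_w_neg_iff Im_cnj_z by (simp add: algebra_simps power_add)
qed

lemma turn_w_b:
  assumes "n + 2 \<le> k"
  shows "turn (w (Suc n)) (w (Suc (Suc n))) b < 0"
proof -
  have "0 < y * S (int n + 1) - r ^ 3 * S (int n) + r ^ (n + 2) * S 1"
    using Phi_le_pos[of "n + 2"] assms by (simp add: add.commute)
  then have "0 < c * r ^ (n + 1) * (y * S (int n + 1) - r ^ 3 * S (int n) + r ^ (n + 2) * S 1)"
    using c_pos r_pos by simp
  moreover have "S (int n) = r * (S (int n + 1) + S (int n - 1))" by (rule S_rec)
  then have "c * r ^ n * (y * S (int n) + r ^ (n + 3) * S 1)
      - c * r ^ (n + 1) * (y * S (int n - 1) + r ^ 3 * S (int n))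
      = c * r ^ (n + 1) * (y * S (int n + 1) - r ^ 3 * S (int n) + r ^ (n + 2) * S 1)"
    by (simp add: algebra_simps eval_nat_numeral)
  ultimately show ?thesis unfolding turn_w_neg_iff Im_cnj_b by linarith
qed

lemma turn_w_f2b:
  assumes "n + 2 \<le> k"
  shows "turn (w (Suc n)) (w (Suc (Suc n))) (f2 \<eta> b) \<le> 0"
proof -
  have "y * (1 - r\<^sup>2) * S (int n) \<le> y * S (int n)"
  proof -
    have "0 \<le> y * r\<^sup>2 * S (int n)" using y_pos assms by (intro mult_nonneg_nonneg S_nonneg) auto
    then show ?thesis by (simp add: algebra_simps)
  qed
  moreover have "0 \<le> r ^ 5 * S (int n + 1)" using r_pos assms by (intro mult_nonneg_nonneg S_nonneg) auto
  moreover have "0 < r ^ (n + 3) * S 1" using r_pos S1_pos by simp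
  ultimately show ?thesis
    unfolding turn_w_neg_iff Im_cnj_f2b using c_pos r_pos by (intro mult_left_mono) auto
qed

subsection \<open>The edges joining the spirals\<close>

text \<open>Cross product with the joining edge from \<open>z k\<close> to \<open>w 1\<close>,
  without a base point, so that it is linear and can be evaluated on powers of
  \<open>a\<close>.\<close>

definition M :: "complex \<Rightarrow> real" where
  "M p = Im (cnj (w 1 - z k) * p)"

lemma M_diff: "M (p - q) = M p - M q" and M_minus: "M (- p) = - M p"
  and M_add: "M (p + q) = M p + M q" and M_scale: "M (of_real t * p) = t * M p"
  by (simp_all add: M_def algebra_simps)

lemma Im_eq_neg_cnj: "Im u = - Im (cnj u)"
  by simp

lemma M_pow: "M (a ^ j) = - (c * r ^ j * supp_val (int j))"
proof -
  have "M (a ^ j) = - Im (cnj (cnj (w 1 - z k) * a ^ j))" unfolding M_def by (rule Im_eq_neg_cnj)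
  also have "cnj (cnj (w 1 - z k) * a ^ j) = cnj a ^ j * w 1 - cnj a ^ j * z k"
    by (simp add: algebra_simps)
  also have "- Im \<dots> = - (c * r ^ j * (y * S (int j) - r ^ 3 * S (int j - 1))
      - c * r ^ (k + j + 1) * S (int j - int k - 1))"
    unfolding minus_complex.sel Im_cnj_w Im_cnj_z by (simp add: eval_nat_numeral)
  also have "int j - int k - 1 = - (int k + 1 - int j)" by simp
  finally show ?thesis
    unfolding sm_minus supp_val_def by (simp add: algebra_simps power_add)
qed

lemma M_pow_neg: "j < k \<Longrightarrow> M (a ^ j) < 0"
  unfolding M_pow using supp_val_pos[of "int j"] c_pos r_pos by simp

lemma M_1_neg: "M 1 < 0" and M_a_neg: "M a < 0"
  using M_pow_neg[of 0] M_pow_neg[of 1] k4 by simp_all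

lemma M_pow_k: "0 \<le> M (a ^ k)"
  unfolding M_pow using supp_val_k c_pos r_pos by (simp add: mult_le_0_iff)

text \<open>Since \<open>cnj a = r ^ 2 / a\<close>, this is the case of exponent -1 in
  \<open>M_pow\<close>; it is reached through \<open>cnj a = 1 - a\<close> and the recurrence that
  \<open>supp_val\<close> inherits.\<close>

lemma M_cnj_a: "0 \<le> M (cnj a)"
proof -
  have rec: "supp_val 0 = r * (supp_val 1 + supp_val (-1))"
  proof -
    have 1: "S (-1) = r * (S 0 + S (-2))" using S_rec[of "-1"] by simp
    have 2: "S (int k + 1) = r * (S (int k + 2) + S (int k))" using S_rec[of "int k + 1"] by (simp add: add.commute)
    show ?thesis
      unfolding supp_val_def using 1 2 by (simp add: S_m1 algebra_simps)
  qed
  have "M (cnj a) = M 1 - M a" unfolding cnj_a M_diff ..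
  also have "\<dots> = c * (r * supp_val 1 - supp_val 0)"
    using M_pow[of 0] M_pow[of 1] by (simp add: algebra_simps)
  also have "\<dots> = - (c * r * supp_val (-1))" unfolding rec by (simp add: algebra_simps)
  also have "\<dots> \<ge> 0" using supp_val_minus1 c_pos r_pos by (simp add: mult_le_0_iff)
  finally show ?thesis .
qed

lemma M_z_k: "M (z k) = M (w 1)"
proof -
  have "M (w 1 - z k) = 0" by (simp add: M_def algebra_simps)
  then show ?thesis by (simp add: M_diff)
qed

lemma turn_m: "turn (z k) (w 1) p = M p - M (w 1)"
  unfolding turn_eq_translate M_def by (simp only: right_diff_distrib minus_complex.sel)

lemma M_w_Suc: "M (w (Suc (Suc n))) = M (w (Suc n)) + c * r ^ 4 * M (a ^ n)"
  using w_Suc_diff[of n] unfolding diff_eq_eq by (simp only: M_add M_scale add.commute)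

lemma M_z_Suc: "M (z (Suc j)) = M (z j) - c * r\<^sup>2 * M (a ^ j)"
  using z_Suc_diff[of j] unfolding diff_eq_eq by (simp only: M_add M_minus M_scale)

text \<open>Each step adds a positive multiple of some \<open>a ^ n\<close> with
  \<open>n < k\<close>, where \<open>M\<close> is negative. The range includes
  \<open>w (k + 1)\<close>, needed for \<open>f1 (w k)\<close>.\<close>

lemma M_w_less:
  assumes "1 \<le> n" "n \<le> k"
  shows "M (w (Suc n)) < M (w 1)"
  using assms
proof (induction n rule: dec_induct)
  case base
  show ?case using M_w_Suc[of 0] M_1_neg c_pos r_pos by (simp add: mult_pos_neg)
next
  case (step n)
  have "c * r ^ 4 * M (a ^ n) < 0"
    using M_pow_neg[of n] step pos_coeffs(2) by (intro mult_pos_neg) auto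
  then show ?case using M_w_Suc[of n] step by simp
qed

lemma turn_m_w:
  assumes "2 \<le> i" "i \<le> k"
  shows "turn (z k) (w 1) (w i) < 0"
  unfolding turn_m using M_w_less[of "i - 1"] assms by simp

lemma turn_m_z:
  assumes "i < k"
  shows "turn (z k) (w 1) (z i) < 0"
proof -
  have "M (z i) < M (z k)"
    using assms
  proof (induction rule: strict_inc_induct)
    case (base i)
    have "c * r\<^sup>2 * M (a ^ i) < 0" using M_pow_neg[of i] base pos_coeffs(1) by (intro mult_pos_neg) auto
    then show ?case using M_z_Suc[of i] base by simp
  next
    case (step i)
    have "c * r\<^sup>2 * M (a ^ i) < 0" using M_pow_neg[of i] step pos_coeffs(1) by (intro mult_pos_neg) auto
    then show ?case using M_z_Suc[of i] step by simp
  qed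
  then show ?thesis unfolding turn_m M_z_k by simp
qed

lemma turn_m_z_Suc_k: "turn (z k) (w 1) (z (Suc k)) \<le> 0"
  unfolding turn_m M_z_Suc M_z_k using M_pow_k pos_coeffs(1) by simp

text \<open>Both coefficients are positive because \<open>2 * r ^ 4 < 1\<close>, so the signs of
  \<open>M a\<close> and \<open>M (cnj a)\<close> settle the position of \<open>b\<close>.\<close>

lemma b_w1_diff: "b - w 1 = of_real (c * (r\<^sup>2 + r ^ 4)) * a - of_real (c * (1 - 2 * r ^ 4)) * cnj a"
proof -
  have "c * (1 - 2 * r ^ 4) = 1 - c * r ^ 4" using c_r4 by (simp add: algebra_simps)
  then have "of_real (c * (r\<^sup>2 + r ^ 4)) * a - of_real (c * (1 - 2 * r ^ 4)) * cnj a
    = of_real (c * r\<^sup>2 + c * r ^ 4) * a - of_real (1 - c * r ^ 4) * (1 - a)"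
    by (simp add: cnj_a distrib_left)
  then show ?thesis by (simp add: b_eq w_eq algebra_simps)
qed

lemma turn_m_b: "turn (z k) (w 1) b < 0"
proof -
  have "turn (z k) (w 1) b = M (b - w 1)" unfolding turn_m M_diff ..
  also have "\<dots> = c * (r\<^sup>2 + r ^ 4) * M a - c * (1 - 2 * r ^ 4) * M (cnj a)"
    unfolding b_w1_diff M_diff M_scale ..
  also have "\<dots> < 0"
  proof -
    have "c * (r\<^sup>2 + r ^ 4) * M a < 0" using c_pos r_pos M_a_neg by (intro mult_pos_neg) (auto simp: add_pos_pos)
    moreover have "c * (1 - 2 * r ^ 4) * M (cnj a) \<ge> 0" using c_pos r_power4_lt_half M_cnj_a by simp
    ultimately show ?thesis by linarith
  qed
  finally show ?thesis .
qed

lemma turn_m_w0: "turn (z k) (w 1) (w 0) \<le> 0"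
proof -
  have "M (w 1) - M (w 0) = c * r\<^sup>2 * M (cnj a)" unfolding M_diff[symmetric] w_1_0_diff M_scale ..
  also have "\<dots> \<ge> 0" using pos_coeffs(1) M_cnj_a by simp
  finally show ?thesis unfolding turn_m by simp
qed

lemma turn_m_f1w:
  assumes "1 \<le> i" "i \<le> k"
  shows "turn (z k) (w 1) (f1 \<eta> (w i)) \<le> 0"
  unfolding turn_m f1_w M_diff using M_w_less[OF assms] M_cnj_a by simp

lemma turn_m_f2b: "turn (z k) (w 1) (f2 \<eta> b) \<le> 0"
proof -
  have "f2 \<eta> b - w 1 = of_real (c * r\<^sup>2) * a - of_real (r\<^sup>2) * (a + cnj a) - of_real (c * r ^ 4) * cnj a"
    by (simp add: f2_b w_eq cnj_a algebra_simps)
  also have "\<dots> = of_real ((c - 1) * r\<^sup>2) * a - of_real (r\<^sup>2 + c * r ^ 4) * cnj a"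
    by (simp add: algebra_simps)
  finally have "M (f2 \<eta> b) - M (w 1) = (c - 1) * r\<^sup>2 * M a - (r\<^sup>2 + c * r ^ 4) * M (cnj a)"
    unfolding M_diff[symmetric] by (simp only: M_diff M_scale)
  also have "\<dots> \<le> 0"
  proof -
    have "(c - 1) * r\<^sup>2 * M a \<le> 0"
      using c_r4 pos_coeffs(2) M_a_neg by (simp add: mult_le_0_iff)
    moreover have "(r\<^sup>2 + c * r ^ 4) * M (cnj a) \<ge> 0"
      using pos_coeffs(2) M_cnj_a by (intro mult_nonneg_nonneg) auto
    ultimately show ?thesis by linarith
  qed
  finally show ?thesis unfolding turn_m .
qed

text \<open>This edge is \<open>- cnj a\<close> times the joining edge, so its turn is
  \<open>M\<close> after multiplication by \<open>a\<close>. The two forms use either endpoint as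
  base point.\<close>

lemma turn_c: "turn (w k) b p = M (a * w k) - M (a * p)" "turn (w k) b p = M (a * b) - M (a * p)"
proof -
  have e: "b - w k = - (cnj a * (w 1 - z k))"
    using f2_w1 f2_z[of k] by (simp add: f2_def algebra_simps)
  show "turn (w k) b p = M (a * w k) - M (a * p)"
    unfolding turn_def e M_def by (simp add: algebra_simps)
  show "turn (w k) b p = M (a * b) - M (a * p)"
    unfolding turn_eq_translate e M_def by (simp add: algebra_simps)
qed

lemma M_a_w_Suc: "M (a * w (Suc (Suc n))) = M (a * w (Suc n)) + c * r ^ 4 * M (a ^ Suc n)"
proof -
  have "a * w (Suc (Suc n)) = a * w (Suc n) + of_real (c * r ^ 4) * a ^ Suc n"
    using w_Suc_diff[of n] by (simp add: algebra_simps)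
  then show ?thesis by (simp only: M_add M_scale)
qed

lemma M_a_z_Suc: "M (a * z (Suc j)) = M (a * z j) - c * r\<^sup>2 * M (a ^ Suc j)"
proof -
  have "a * z (Suc j) = a * z j + a * (z (Suc j) - z j)" by (simp add: algebra_simps)
  also have "\<dots> = a * z j - of_real (c * r\<^sup>2) * a ^ Suc j" unfolding z_Suc_diff by simp
  finally show ?thesis by (simp only: M_diff M_scale)
qed

lemma M_a_cnj_a: "M (a * cnj a) < 0"
  unfolding a_cnj_a using M_scale[of "r\<^sup>2" 1] M_1_neg r_pos by (simp add: mult_pos_neg)

lemma turn_c_w:
  assumes "i < k"
  shows "turn (w k) b (w i) < 0"
proof -
  have pos: "M (a * w (Suc n)) > M (a * w k)" if "Suc n < k" for n
    using that
  proof (induction "Suc n" arbitrary: n rule: strict_inc_induct)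
    case (base)
    have "c * r ^ 4 * M (a ^ Suc n) < 0" using M_pow_neg[of "Suc n"] base pos_coeffs(2) by (intro mult_pos_neg) auto
    then show ?case using M_a_w_Suc[of n] base by simp
  next
    case (step)
    have "c * r ^ 4 * M (a ^ Suc n) < 0" using M_pow_neg[of "Suc n"] step pos_coeffs(2) by (intro mult_pos_neg) auto
    then show ?case using M_a_w_Suc[of n] step by simp
  qed
  show ?thesis
  proof (cases i)
    case (Suc n)
    then show ?thesis using pos[of n] assms by (simp add: turn_c(1))
  next
    case 0
    \<comment> \<open>The step from \<open>w 0\<close> to \<open>w 1\<close> has direction
      \<open>cnj a\<close>, not a nonnegative power of \<open>a\<close>, so the induction does not
      cover it.\<close>
    have "a * w 0 = a * w 1 - of_real (c * r\<^sup>2) * (a * cnj a)"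
      using w_1_0_diff by (simp add: algebra_simps)
    then have "M (a * w 0) = M (a * w 1) - c * r\<^sup>2 * M (a * cnj a)"
      by (simp only: M_diff M_scale)
    moreover have "c * r\<^sup>2 * M (a * cnj a) < 0" using M_a_cnj_a pos_coeffs(1) by (intro mult_pos_neg)
    ultimately show ?thesis using pos[of 0] k4 0 by (simp add: turn_c(1))
  qed
qed

lemma turn_c_f1w:
  assumes "1 \<le> i" "i \<le> k"
  shows "turn (w k) b (f1 \<eta> (w i)) \<le> 0"
proof -
  obtain k' where k': "k = Suc k'" using k4 by (cases k) auto
  have "M (a * w (Suc i)) \<ge> M (a * w k)"
  proof -
    consider "Suc i < k" | "Suc i = k" | "i = k" using assms by linarith
    then show ?thesis
    proof cases
      case 1 then show ?thesis using turn_c_w[of "Suc i"] by (simp add: turn_c(1))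
    next
      case 2 then show ?thesis by simp
    next
      case 3
      \<comment> \<open>The step past the last vertex to \<open>w (k + 1)\<close> is where the sign
        of \<open>Phi (k + 1) \<eta>\<close> enters.\<close>
      have "c * r ^ 4 * M (a ^ k) \<ge> 0" using M_pow_k pos_coeffs(2) by simp
      then show ?thesis using M_a_w_Suc[of k'] 3 k' by simp
    qed
  qed
  moreover have "M (a * f1 \<eta> (w i)) = M (a * w (Suc i)) - M (a * cnj a)"
    unfolding f1_w right_diff_distrib M_diff ..
  ultimately show ?thesis using M_a_cnj_a by (simp add: turn_c(1))
qed

text \<open>\<open>M (a * z i)\<close> increases along the spiral while
  \<open>M (a ^ i) < 0\<close>, which fails at \<open>i = k\<close>. There \<open>z k\<close> is
  compared with \<open>w 1\<close>: \<open>M (a * (w 1 - z k))\<close> is a squared length times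
  \<open>Im a\<close>.\<close>

lemma turn_c_z:
  assumes "i \<le> k"
  shows "turn (w k) b (z i) < 0"
proof (cases "i = k")
  case True
  have "M (a * (w 1 - z k)) = (cmod (w 1 - z k))\<^sup>2 * Im a"
  proof -
    have "cnj (w 1 - z k) * (a * (w 1 - z k)) = of_real ((cmod (w 1 - z k))\<^sup>2) * a"
      unfolding complex_norm_square by (simp only: mult_ac)
    then show ?thesis unfolding M_def by (simp only: Im_of_real_times)
  qed
  also have "\<dots> \<le> 0" unfolding Im_a using r_pos S1_pos by (simp add: mult_le_0_iff)
  finally have "M (a * w 1) \<le> M (a * z k)" by (simp add: right_diff_distrib M_diff)
  moreover have "M (a * w k) < M (a * w 1)" using turn_c_w[of 1] k4 by (simp add: turn_c(1))
  ultimately show ?thesis using True by (simp add: turn_c(1))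
next
  case False
  then have "i < k" using assms by simp
  then have "M (a * b) < M (a * z i)"
  proof (induction i)
    case 0
    have "a * z 0 = a * b + a * (z 0 - b)" by (simp add: algebra_simps)
    also have "\<dots> = a * b - of_real (c * r ^ 4) * (a * cnj a)" unfolding z0_b_diff by simp
    finally have "M (a * z 0) = M (a * b) - c * r ^ 4 * M (a * cnj a)"
      by (simp only: M_diff M_scale)
    moreover have "c * r ^ 4 * M (a * cnj a) < 0" using M_a_cnj_a pos_coeffs(2) by (intro mult_pos_neg)
    ultimately show ?case by simp
  next
    case (Suc i)
    have "c * r\<^sup>2 * M (a ^ Suc i) < 0" using M_pow_neg[of "Suc i"] Suc pos_coeffs(1) by (intro mult_pos_neg) auto
    then show ?case using M_a_z_Suc[of i] Suc by simp
  qed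
  then show ?thesis by (simp add: turn_c(2))
qed

lemma turn_c_f2b: "turn (w k) b (f2 \<eta> b) \<le> 0"
  using turn_f2[of "z k" "w 1" b] turn_m_b by (simp add: f2_z f2_w1[simplified] mult_le_0_iff)

text \<open>A triangle of three vertices replaces tests against all edges. Its sides use, in this
  order, \<open>Phi (k + 1) \<eta> \<le> 0\<close>, then \<open>Phi k \<eta> > 0\<close>, then the
  bounds on \<open>S (k + 1)\<close> and \<open>S (k + 3)\<close>.\<close>

lemma z_Suc_k_in_triangle: "z (Suc k) \<in> convex hull {z k, w 1, b}"
proof (rule in_triangle_hull)
  show "turn (z k) (w 1) b < 0" by (rule turn_m_b)
  show "turn (z k) (w 1) (z (Suc k)) \<le> 0" by (rule turn_m_z_Suc_k)
  show "turn b (z k) (z (Suc k)) \<le> 0"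
  proof -
    have "turn b (z k) (z (Suc k)) = Im (cnj (z k - b) * (- (of_real (c * r\<^sup>2) * a ^ k)))"
      unfolding turn_eq_translate z_Suc_diff ..
    also have "\<dots> = - (c * r\<^sup>2 * Im (cnj (z k - b) * a ^ k))" by (simp add: algebra_simps)
    also have "Im (cnj (z k - b) * a ^ k) = - Im (cnj (cnj (z k - b) * a ^ k))"
      by (rule Im_eq_neg_cnj)
    also have "cnj (cnj (z k - b) * a ^ k) = cnj a ^ k * z k - cnj a ^ k * b" by (simp add: algebra_simps)
    also have "- (c * r\<^sup>2 * - Im (cnj a ^ k * z k - cnj a ^ k * b)) =
        - (c * r\<^sup>2 * (c * r ^ (k + 1) * (r ^ k * S 1 + y * S (int k - 1) + r ^ 3 * S (int k))))"
      unfolding minus_complex.sel Im_cnj_z Im_cnj_b by (simp add: S_m1 algebra_simps power_add)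
    also have "\<dots> \<le> 0"
    proof -
      have "S (int k - 1) = r * (S (int k) + S (int k - 2))" using S_rec[of "int k - 1"] by simp
      moreover have "S (int k - 1) > 0" using k4 by (intro S_pos) auto
      ultimately have "S (int k) + S (int k - 2) > 0" using r_pos by (simp add: zero_less_mult_iff)
      then have "r ^ 3 * (S (int k) + S (int k - 2)) > 0" using r_pos by simp
      then have "r ^ k * S 1 + y * S (int k - 1) + r ^ 3 * S (int k) > 0"
        using Phi_le_pos[of k] k4 by (simp add: algebra_simps)
      then show ?thesis using c_pos r_pos by simp
    qed
    finally show ?thesis .
  qed
  show "turn (w 1) b (z (Suc k)) \<le> 0"
  proof -
    define q where "q = z (Suc k) - b"
    have q1: "Im (cnj a * q) = - (c * (r ^ (k + 3) * S (int k + 1) + r ^ 5 * S 1))"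
    proof -
      have "Im (cnj a * q) = Im (cnj a ^ 1 * z (Suc k)) - Im (cnj a ^ 1 * b)"
        by (simp add: q_def right_diff_distrib)
      moreover have "int 1 - int (Suc k) - 1 = - (int k + 1)" by simp
      then have "S (int 1 - int (Suc k) - 1) = - S (int k + 1)" by (simp only: sm_minus)
      ultimately show ?thesis
        unfolding Im_cnj_z Im_cnj_b by (simp add: algebra_simps eval_nat_numeral)
    qed
    have "Im (a * b) + c * r * S 1 = 0" using turn_b[of b] c_pos r_pos by simp
    then have q2: "Im (a * q) = - (c * r * (r ^ (k + 2) * S (int k + 3) - S 1))"
      using Im_a_z[of "Suc k"] by (simp add: q_def algebra_simps)
    have "turn (w 1) b (z (Suc k)) = Im (cnj (b - w 1) * q)" by (simp add: turn_eq_translate q_def)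
    also have "cnj (b - w 1) * q = of_real (c * (r\<^sup>2 + r ^ 4)) * (cnj a * q) - of_real (c * (1 - 2 * r ^ 4)) * (a * q)"
      unfolding b_w1_diff by (simp add: algebra_simps)
    also have "Im \<dots> = c * (r\<^sup>2 + r ^ 4) * Im (cnj a * q) - c * (1 - 2 * r ^ 4) * Im (a * q)"
      by (simp only: minus_complex.sel Im_of_real_times)
    also have "\<dots> \<le> 0"
    proof -
      have "r ^ (k + 3) * S (int k + 1) + r ^ 5 * S 1 = r\<^sup>2 * (r ^ 3 * S 1 + r ^ (k + 1) * S (int k + 1))"
        by (simp add: algebra_simps power_add eval_nat_numeral)
      also have "\<dots> > 0" using S_k1_gt' r_pos by simp
      finally have 1: "Im (cnj a * q) \<le> 0" unfolding q1 using c_pos by simp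
      have "Im (a * q) \<ge> 0" unfolding q2 using S_k3_le c_pos r_pos by (simp add: mult_le_0_iff)
      then have "c * (1 - 2 * r ^ 4) * Im (a * q) \<ge> 0" using c_pos r_power4_lt_half by simp
      moreover have "c * (r\<^sup>2 + r ^ 4) * Im (cnj a * q) \<le> 0"
        using 1 c_pos by (intro mult_nonneg_nonpos) auto
      ultimately show ?thesis by linarith
    qed
    finally show ?thesis .
  qed
qed

subsection \<open>The invariant polygon\<close>

definition vertices :: "complex list" where
  "vertices = [b] @ map z [0..<k+1] @ map w [1..<k+1]"

lemma length_vertices: "length vertices = 2 * k + 2"
  by (simp add: vertices_def)

lemma vertices_nth:
  "vertices ! 0 = b"
  "j \<le> k \<Longrightarrow> vertices ! Suc j = z j"
  "1 \<le> j \<Longrightarrow> j \<le> k \<Longrightarrow> vertices ! (k + 1 + j) = w j"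
  "1 \<le> j \<Longrightarrow> j \<le> k \<Longrightarrow> vertices ! Suc (k + j) = w j"
  by (auto simp: vertices_def nth_append simp del: upt_Suc)

lemma set_vertices: "set vertices = insert b (z ` {..k} \<union> w ` {1..k})"
  by (auto simp: vertices_def simp del: upt_Suc)

lemma vertex_cases:
  assumes "i < length vertices"
  obtains "i = 0" | j where "i = Suc j" "j \<le> k" | j where "i = k + 1 + j" "1 \<le> j" "j \<le> k"
proof -
  consider "i = 0" | "1 \<le> i" "i \<le> k + 1" | "k + 2 \<le> i" using assms by linarith
  then show thesis
  proof cases
    case 2
    then show thesis using that(2)[of "i - 1"] by auto
  next
    case 3
    then show thesis using that(3)[of "i - (k + 1)"] assms by (auto simp: length_vertices)
  qed (use that in auto)
qed

text \<open>Position \<open>j + 1\<close> holds \<open>z j\<close> and position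
  \<open>k + 1 + j\<close> holds \<open>w j\<close>; the last edge wraps around to
  \<open>b\<close>.\<close>

lemma edge_cases:
  assumes "i < length vertices"
  obtains "i = 0" "vertices ! i = b" "vertices ! (Suc i mod length vertices) = z 0"
      "Suc i mod length vertices = 1"
    | j where "i = Suc j" "j < k" "vertices ! i = z j" "vertices ! (Suc i mod length vertices) = z (Suc j)"
      "Suc i mod length vertices = Suc (Suc j)"
    | "i = Suc k" "vertices ! i = z k" "vertices ! (Suc i mod length vertices) = w 1"
      "Suc i mod length vertices = k + 2"
    | n where "i = k + 2 + n" "n + 2 \<le> k" "vertices ! i = w (Suc n)"
      "vertices ! (Suc i mod length vertices) = w (Suc (Suc n))" "Suc i mod length vertices = k + 3 + n"
    | "i = k + 1 + k" "vertices ! i = w k" "vertices ! (Suc i mod length vertices) = b"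
      "Suc i mod length vertices = 0"
  using assms
proof (cases rule: vertex_cases)
  case 1
  then show thesis using that(1) k4 vertices_nth(2)[of 0] by (simp add: length_vertices vertices_nth)
next
  case (2 j)
  show thesis
  proof (cases "j = k")
    case True
    then show thesis using that(3) 2 k4 vertices_nth(3)[of 1] by (simp add: length_vertices vertices_nth)
  next
    case False
    then show thesis using that(2)[of j] 2 vertices_nth(2)[of "Suc j"] by (simp add: length_vertices vertices_nth)
  qed
next
  case (3 j)
  show thesis
  proof (cases "j = k")
    case True
    then show thesis using that(5) 3 vertices_nth(3)[of k] by (simp add: length_vertices vertices_nth mult_2)
  next
    case False
    then obtain n where n: "j = Suc n" "n + 2 \<le> k" using 3 by (cases j) auto
    then show thesis
      using that(4)[of n] 3 vertices_nth(3)[of j] vertices_nth(3)[of "Suc j"] by (simp add: length_vertices)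
  qed
qed

sublocale polygon: clockwise_polygon vertices
proof
  show "3 \<le> length vertices" using k4 by (simp add: length_vertices)
next
  fix i j
  assume i: "i < length vertices" and j: "j < length vertices" "j \<noteq> i" "j \<noteq> Suc i mod length vertices"
  show "turn (vertices ! i) (vertices ! (Suc i mod length vertices)) (vertices ! j) < 0"
    using i
  proof (cases rule: edge_cases)
    case 1
    from j(1) show ?thesis
      by (cases rule: vertex_cases) (use 1 j turn_b_z turn_b_w in \<open>auto simp: vertices_nth\<close>)
  next
    case (2 m)
    from j(1) show ?thesis
      by (cases rule: vertex_cases) (use 2 j turn_z_z turn_z_w turn_z_b in \<open>auto simp: vertices_nth\<close>)
  next
    case 3
    from j(1) show ?thesis
    proof (cases rule: vertex_cases)
      case 1 then show ?thesis using 3 turn_m_b by (simp only: vertices_nth)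
    next
      case (2 l) then show ?thesis using 3 j turn_m_z[of l] by (simp only: vertices_nth)
    next
      case (3 l)
      then have "2 \<le> l" using \<open>Suc i mod length vertices = k + 2\<close> j by auto
      then have "turn (z k) (w 1) (w l) < 0" using 3 by (intro turn_m_w) auto
      then show ?thesis
        using 3 vertices_nth(3)[of l] \<open>vertices ! i = z k\<close> \<open>vertices ! (Suc i mod length vertices) = w 1\<close>
        by (simp only:)
    qed
  next
    case (4 n)
    from j(1) show ?thesis
    proof (cases rule: vertex_cases)
      case 1 then show ?thesis using 4 turn_w_b[of n] by (simp only: vertices_nth)
    next
      case (2 l) then show ?thesis using 4 turn_w_z[of n l] by (simp only: vertices_nth)
    next
      case (3 l)
      then have "turn (w (Suc n)) (w (Suc (Suc n))) (w l) < 0"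
        using 4 j by (intro turn_w_w) auto
      then show ?thesis using 3 4 vertices_nth(3)[of l] by (simp only:)
    qed
  next
    case 5
    from j(1) show ?thesis
    proof (cases rule: vertex_cases)
      case 1 then show ?thesis using 5 j by simp
    next
      case (2 l) then show ?thesis using 5 turn_c_z[of l] by (simp only: vertices_nth)
    next
      case (3 l)
      then have "turn (w k) b (w l) < 0" using 5 j by (intro turn_c_w) auto
      then show ?thesis using 3 5 vertices_nth(3)[of l] by (simp only:)
    qed
  qed
qed

abbreviation "P \<equiv> convex hull (set vertices)"

section \<open>Images of the vertices lie in the polygon\<close>

lemma in_P: "b \<in> P" "j \<le> k \<Longrightarrow> z j \<in> P" "1 \<le> j \<Longrightarrow> j \<le> k \<Longrightarrow> w j \<in> P"
  by (auto intro!: hull_inc simp: set_vertices)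

lemma in_P_if_right_of_edges:
  assumes "turn b (z 0) p \<le> 0" "\<And>j. j < k \<Longrightarrow> turn (z j) (z (Suc j)) p \<le> 0" "turn (z k) (w 1) p \<le> 0"
    and "\<And>n. n + 2 \<le> k \<Longrightarrow> turn (w (Suc n)) (w (Suc (Suc n))) p \<le> 0" "turn (w k) b p \<le> 0"
  shows "p \<in> P"
proof (rule polygon.in_hull)
  fix i assume "i < length vertices"
  then show "turn (vertices ! i) (vertices ! (Suc i mod length vertices)) p \<le> 0"
    by (cases rule: edge_cases) (simp_all only: assms)
qed

lemma w_0_in_P: "w 0 \<in> P"
  using turn_b_w[of 0] turn_z_w0 turn_m_w0 turn_w_w[of _ 0] turn_c_w[of 0] k4
  by (intro in_P_if_right_of_edges) (auto intro: less_imp_le)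

lemma f1_w_in_P:
  assumes "1 \<le> i" "i \<le> k"
  shows "f1 \<eta> (w i) \<in> P"
  using turn_b_f1w turn_z_f1w turn_m_f1w turn_w_f1w turn_c_f1w assms
  by (intro in_P_if_right_of_edges) auto

lemma f2_b_in_P: "f2 \<eta> b \<in> P"
  using turn_b_f2b turn_z_f2b turn_m_f2b turn_w_f2b turn_c_f2b
  by (intro in_P_if_right_of_edges) auto

lemma z_Suc_k_in_P: "z (Suc k) \<in> P"
proof -
  have "convex hull {z k, w 1, b} \<subseteq> P"
    using k4 by (intro hull_minimal) (auto intro: in_P)
  then show ?thesis using z_Suc_k_in_triangle by blast
qed

lemma convex_combination_in_P:
  assumes "p \<in> P" "q \<in> P"
  shows "of_real (1 - r ^ 4) * p + of_real (r ^ 4) * q \<in> P"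
proof -
  have "(1 - r ^ 4) *\<^sub>R p + (r ^ 4) *\<^sub>R q \<in> P"
    using assms y_pos r_pos by (intro convexD[OF convex_convex_hull]) auto
  then show ?thesis by (simp only: scaleR_conv_of_real)
qed

lemma f1_vertices: "f1 \<eta> ` set vertices \<subseteq> P"
proof -
  have "f1 \<eta> (z j) \<in> P" if "j \<le> k" for j
    unfolding f1_z using in_P(2)[of "Suc j"] z_Suc_k_in_P that by (cases "j = k") auto
  moreover have "f1 \<eta> b \<in> P"
    unfolding f1_b using k4 by (intro convex_combination_in_P in_P) auto
  ultimately show ?thesis using f1_w_in_P by (auto simp: set_vertices)
qed

lemma f2_vertices: "f2 \<eta> ` set vertices \<subseteq> P"
proof -
  have "f2 \<eta> (z j) \<in> P" if "j \<le> k" for j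
    unfolding f2_z using in_P(3)[of j] w_0_in_P that by (cases "j = 0") auto
  moreover have "f2 \<eta> (w j) \<in> P" if j: "1 \<le> j" "j \<le> k" for j
  proof (cases "j = 1")
    case True
    then show ?thesis using f2_w1 in_P(1) by (simp only:)
  next
    case False
    then have "j = Suc (Suc (j - 2))" using j by simp
    then obtain i where i: "j = Suc (Suc i)" by blast
    then show ?thesis
      using j by (simp only: f2_w_Suc) (intro convex_combination_in_P in_P, auto)
  qed
  ultimately show ?thesis using f2_b_in_P by (auto simp: set_vertices)
qed

text \<open>Affine maps commute with convex hulls, so invariance need only be checked at the
  vertices.\<close>

lemma affine_image_P:
  assumes "(\<lambda>p. u + v * p) ` set vertices \<subseteq> P"
  shows "(\<lambda>p. u + v * p) ` P \<subseteq> P"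
proof -
  have "(\<lambda>p. u + v * p) ` P = (+) u ` ((*) v ` P)" by (simp add: image_image)
  also have "\<dots> = convex hull ((+) u ` ((*) v ` set vertices))"
    by (simp add: convex_hull_linear_image[symmetric] convex_hull_translation bounded_linear.linear
        bounded_linear_mult_right)
  also have "\<dots> = convex hull ((\<lambda>p. u + v * p) ` set vertices)" by (simp add: image_image)
  also have "\<dots> \<subseteq> P" using assms by (intro hull_minimal) auto
  finally show ?thesis .
qed

section \<open>The attractor and its convex hull\<close>

lemma attractor_subset:
  assumes "compact K" "K = f1 \<eta> ` K \<union> f2 \<eta> ` K"
  shows "K \<subseteq> P"
proof (rule invariant_subset_hull[OF assms])
  show "f1 \<eta> ` P \<subseteq> P"
    using affine_image_P[of 0 a] f1_vertices by (simp add: f1_def[abs_def])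
  show "f2 \<eta> ` P \<subseteq> P"
    using affine_image_P[of 1 "- cnj a"] f2_vertices by (simp add: f2_def[abs_def])
  show "dist (f1 \<eta> p) (f1 \<eta> q) \<le> r * dist p q" for p q
    by (simp add: f1_def dist_norm norm_mult cmod_a flip: right_diff_distrib)
  show "dist (f2 \<eta> p) (f2 \<eta> q) \<le> r * dist p q" for p q
    by (simp add: f2_def dist_norm norm_mult cmod_a norm_minus_commute flip: right_diff_distrib)
qed (use r_pos r_lt_1 k4 in \<open>auto simp: set_vertices\<close>)

text \<open>\<open>g\<close> contracts by \<open>r ^ 4\<close> and preserves \<open>K\<close>.
  Applying Banach's theorem inside the complete set \<open>K\<close> puts its fixed point
  \<open>a / (1 - r ^ 4)\<close>, which is \<open>c * a\<close>, into \<open>K\<close>.\<close>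

lemma z_0_in_attractor:
  assumes K: "compact K" "K \<noteq> {}" "K = f1 \<eta> ` K \<union> f2 \<eta> ` K"
  shows "z 0 \<in> K"
proof -
  have f: "f1 \<eta> p \<in> K" "f2 \<eta> p \<in> K" if "p \<in> K" for p using K(3) that by blast+
  define g where "g p = f2 \<eta> (f2 \<eta> (f1 \<eta> (f1 \<eta> p)))" for p
  have g_eq: "g p = a + of_real (r ^ 4) * p" for p
  proof -
    have "(cnj a)\<^sup>2 * (a * (a * p)) = (a * cnj a)\<^sup>2 * p" by (simp add: power2_eq_square mult_ac)
    also have "\<dots> = of_real (r ^ 4) * p" unfolding a_cnj_a by (simp flip: of_real_power power_mult)
    finally show ?thesis by (simp add: g_def f2_f2 f1_def)
  qed
  have "\<exists>!p\<in>K. g p = p"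
  proof (rule Banach_fix[of K "r ^ 4"])
    show "complete K" using K(1) by (rule compact_imp_complete)
    show "g ` K \<subseteq> K" using f by (auto simp: g_def)
    show "\<And>p q. \<lbrakk>p \<in> K; q \<in> K\<rbrakk> \<Longrightarrow> dist (g p) (g q) \<le> r ^ 4 * dist p q"
      using r_pos by (simp add: g_eq dist_norm norm_mult norm_power flip: right_diff_distrib)
  qed (use K r_pos y_pos in auto)
  then obtain p where p: "p \<in> K" "g p = p" by blast
  have "a = of_real y * p" using p(2) by (simp add: g_eq algebra_simps)
  then have "z 0 = of_real (c * y) * p" by (simp add: z_eq)
  then show ?thesis unfolding c_y using p by simp
qed

lemma vertices_subset_attractor:
  assumes K: "compact K" "K \<noteq> {}" "K = f1 \<eta> ` K \<union> f2 \<eta> ` K"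
  shows "set vertices \<subseteq> K"
proof -
  have f: "f1 \<eta> p \<in> K" "f2 \<eta> p \<in> K" if "p \<in> K" for p using K(3) that by blast+
  have z: "z j \<in> K" for j
    by (induction j) (use z_0_in_attractor[OF K] f(1) f1_z in \<open>auto simp flip: f1_z\<close>)
  have w: "w j \<in> K" for j using f(2)[OF z] by (simp add: f2_z)
  have "b \<in> K" using f(2)[OF w[of 1]] by (simp only: f2_w1)
  then show ?thesis using z w by (auto simp: set_vertices)
qed

lemma hull_attractor:
  assumes "compact K" "K \<noteq> {}" "K = f1 \<eta> ` K \<union> f2 \<eta> ` K"
  shows "convex hull K = P"
  using attractor_subset[OF assms(1,3)] vertices_subset_attractor[OF assms]
  by (intro subset_antisym hull_minimal hull_mono) auto

end

theorem theorem1p3: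
  fixes k :: nat and \<eta> :: real and K :: "complex set"
  assumes "k \<ge> 4"
    and "eta (k + 1) \<le> \<eta>" and "\<eta> < eta k"
    and "compact K" and "K \<noteq> {}" and "K = f1 \<eta> ` K \<union> f2 \<eta> ` K"
  shows "clockwise_vertices
           ([bb \<eta> 0] @ map (zz \<eta>) [0..<k+1] @ map (ww \<eta>) [1..<k+1])
           (convex hull K)"
proof -
  interpret spiral_regime k \<eta>
    using assms(1) eta_regime[OF assms(1-3)] by unfold_locales
  show ?thesis
    using polygon.clockwise_vertices_hull
    unfolding hull_attractor[OF assms(4-6)] vertices_def .
qed

end
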